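(* Let $G$ be a finite group, $p$ a prime dividing $|G|$, $P\in\mathrm{Syl}_p(G)$ and $\Omega=\Omega_1(Z(P))$. If $r_p(G)-r_p(\Omega)\le1$, then the finite space $\mathcal{A}_p(G)'/G$ is contractible.
   Context: $\Omega_1(H)$ is the subgroup generated by the elements of order $p$ of $H$; $r_p(H)$ (the $p$-rank) is the largest $r$ such that $H$ has an elementary abelian subgroup of order $p^r$. $\mathcal{A}_p(G)$ is the poset of non-trivial elementary abelian $p$-subgroups of $G$, with $G$ acting by conjugation. $\mathcal{A}_p(G)'$ is the poset of non-empty chains of $\mathcal{A}_p(G)$ ordered by inclusion, with componentwise action; $\mathcal{A}_p(G)'/G$ is the orbit poset ($\overline{c}\le\overline{d}$ iff some representatives satisfy $c_1\subseteq d_1$), regarded as a finite $T_0$ space whose open sets are the down-sets. *)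

theory Defs
  imports "HOL-Algebra.Generated_Groups" "HOL-Algebra.Multiplicative_Group" "HOL-Analysis.Homotopy"
    "HOL-Computational_Algebra.Primes"
begin

definition elem_ab :: "('a, 'b) monoid_scheme \<Rightarrow> nat \<Rightarrow> 'a set \<Rightarrow> bool" where
  "elem_ab G p E \<longleftrightarrow> subgroup E G
     \<and> (\<forall>x\<in>E. \<forall>y\<in>E. x \<otimes>\<^bsub>G\<^esub> y = y \<otimes>\<^bsub>G\<^esub> x)
     \<and> (\<forall>x\<in>E. x [^]\<^bsub>G\<^esub> p = \<one>\<^bsub>G\<^esub>)"

definition p_rank :: "('a, 'b) monoid_scheme \<Rightarrow> nat \<Rightarrow> 'a set \<Rightarrow> nat" where
  "p_rank G p H = Max {r. \<exists>E. elem_ab G p E \<and> E \<subseteq> H \<and> card E = p ^ r}"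

definition sylow_subgroup :: "('a, 'b) monoid_scheme \<Rightarrow> nat \<Rightarrow> 'a set \<Rightarrow> bool" where
  "sylow_subgroup G p P \<longleftrightarrow> subgroup P G \<and> card P = p ^ multiplicity p (order G)"

definition center_of :: "('a, 'b) monoid_scheme \<Rightarrow> 'a set \<Rightarrow> 'a set" where
  "center_of G H = {x \<in> H. \<forall>y\<in>H. x \<otimes>\<^bsub>G\<^esub> y = y \<otimes>\<^bsub>G\<^esub> x}"

definition Omega1 :: "('a, 'b) monoid_scheme \<Rightarrow> nat \<Rightarrow> 'a set \<Rightarrow> 'a set" where
  "Omega1 G p H = generate G {x \<in> H. group.ord G x = p}"

definition Ap :: "('a, 'b) monoid_scheme \<Rightarrow> nat \<Rightarrow> 'a set set" where
  "Ap G p = {E. elem_ab G p E \<and> E \<noteq> {\<one>\<^bsub>G\<^esub>}}"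

definition Ap_chains :: "('a, 'b) monoid_scheme \<Rightarrow> nat \<Rightarrow> 'a set set set" where
  "Ap_chains G p = {c. c \<noteq> {} \<and> c \<subseteq> Ap G p \<and>
      (\<forall>E\<in>c. \<forall>F\<in>c. E \<subseteq> F \<or> F \<subseteq> E)}"

definition conj_chain :: "('a, 'b) monoid_scheme \<Rightarrow> 'a \<Rightarrow> 'a set set \<Rightarrow> 'a set set" where
  "conj_chain G g c = (\<lambda>E. (\<lambda>x. g \<otimes>\<^bsub>G\<^esub> x \<otimes>\<^bsub>G\<^esub> inv\<^bsub>G\<^esub> g) ` E) ` c"

definition chain_orbits :: "('a, 'b) monoid_scheme \<Rightarrow> nat \<Rightarrow> 'a set set set set" where
  "chain_orbits G p = (\<lambda>c. {conj_chain G g c | g. g \<in> carrier G}) ` Ap_chains G p"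

definition orbit_le :: "'a set set set \<Rightarrow> 'a set set set \<Rightarrow> bool" where
  "orbit_le o1 o2 \<longleftrightarrow> (\<exists>c\<in>o1. \<exists>d\<in>o2. c \<subseteq> d)"

definition orbit_space :: "('a, 'b) monoid_scheme \<Rightarrow> nat \<Rightarrow> 'a set set set topology" where
  "orbit_space G p = topology (\<lambda>U. U \<subseteq> chain_orbits G p \<and>
     (\<forall>x\<in>U. \<forall>y\<in>chain_orbits G p. orbit_le y x \<longrightarrow> y \<in> U))"

end

theory Submission
  imports Defs "HOL-Algebra.Sylow"
begin

text \<open>
  Let \<open>p ^ r\<close> be the order of \<open>\<Omega>\<close>, so that elementary abelian subgroups have order at most \<open>p ^ (r + 1)\<close>;
  call those attaining the bound maximal, and call \<open>E\<close> of central type if it lies in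
  \<open>\<Omega>\<^sub>Q = \<Omega>\<^sub>1(Z(Q))\<close> for some Sylow subgroup \<open>Q\<close>. If \<open>E\<close> is not of central type, it lies in a maximal
  subgroup, unique up to conjugation by the centralizer of \<open>E\<close>. If it is, the \<open>\<Omega>\<^sub>Q\<close> containing \<open>E\<close> are
  conjugate under the centralizer of \<open>E\<close>, and those between \<open>E\<close> and a fixed maximal \<open>M\<close> are conjugate
  under its intersection with the normalizer of \<open>M\<close>. Hence the following operations on chains \<open>c\<close> are
  well defined and monotone on orbits: add a maximal \<open>M\<close> on top of \<open>c\<close> if \<open>c\<close> has a member not of central
  type; then drop the other members that are not of central type; then add some \<open>\<Omega>\<^sub>Q\<close> above the central
  members (and below \<open>M\<close>); then keep only \<open>\<Omega>\<^sub>Q\<close>. Each one is comparable with the next, and comparable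
  maps of finite spaces are homotopic; the first is comparable with the identity and the last is constant.
\<close>

subsection \<open>Actions of p-groups\<close>

text \<open>Orbit-stabilizer: the fibres of \<open>\<lambda>g. \<phi> g x\<close> are left
  translates of the stabilizer of \<open>x\<close>, so they all have its size. The action laws are
  asked for only along the orbit of \<open>x\<close>, since \<open>\<phi>\<close> may behave
  arbitrarily elsewhere.\<close>

lemma (in group) card_orbit_dvd:
  assumes fin: "finite (carrier G)"
    and one: "\<phi> \<one> x = x"
    and mult: "\<And>g h. g \<in> carrier G \<Longrightarrow> h \<in> carrier G \<Longrightarrow> \<phi> (g \<otimes> h) x = \<phi> g (\<phi> h x)"
    and cancel: "\<And>g h. g \<in> carrier G \<Longrightarrow> h \<in> carrier G \<Longrightarrow> \<phi> (inv g) (\<phi> g (\<phi> h x)) = \<phi> h x"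
  shows "card ((\<lambda>g. \<phi> g x) ` carrier G) dvd order G"
proof -
  let ?S = "{g \<in> carrier G. \<phi> g x = x}"
  have fiber: "card {g \<in> carrier G. \<phi> g x = y} = card ?S" if y: "y \<in> (\<lambda>g. \<phi> g x) ` carrier G" for y
  proof -
    obtain h where h: "h \<in> carrier G" "y = \<phi> h x" using y by auto
    have *: "\<phi> (inv h) (\<phi> h x) = x"
      using cancel[OF h(1) one_closed] one by simp
    have "bij_betw (\<lambda>s. h \<otimes> s) ?S {g \<in> carrier G. \<phi> g x = y}"
    proof (rule bij_betw_byWitness[where f' = "\<lambda>s. inv h \<otimes> s"])
      show "(\<otimes>) (inv h) ` {g \<in> carrier G. \<phi> g x = y} \<subseteq> ?S"
        using h * by (auto simp: mult)
    qed (use h in \<open>auto simp: mult m_assoc[symmetric]\<close>)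
    then show ?thesis by (simp add: bij_betw_same_card)
  qed
  have "order G = (\<Sum>g\<in>carrier G. 1)" by (simp add: order_def)
  also have "\<dots> = (\<Sum>y\<in>(\<lambda>g. \<phi> g x) ` carrier G. \<Sum>g\<in>{g \<in> carrier G. \<phi> g x = y}. 1)"
    by (rule sum.image_gen[OF fin])
  also have "\<dots> = card ((\<lambda>g. \<phi> g x) ` carrier G) * card ?S"
    using fiber by simp
  finally show ?thesis by simp
qed

text \<open>The moved points split into orbits whose sizes are powers of \<open>p\<close> other than
  1. Counting moved points serves two purposes later: it gives a fixed point when \<open>p\<close>
  does not divide the size of the set, and further fixed points when it does.\<close>

lemma (in group) p_group_moved_points:
  assumes p: "prime p" and ord: "order G = p ^ k" and X: "finite X"
    and closed: "\<And>g x. g \<in> carrier G \<Longrightarrow> x \<in> X \<Longrightarrow> \<phi> g x \<in> X"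
    and one: "\<And>x. x \<in> X \<Longrightarrow> \<phi> \<one> x = x"
    and mult: "\<And>g h x. g \<in> carrier G \<Longrightarrow> h \<in> carrier G \<Longrightarrow> x \<in> X \<Longrightarrow> \<phi> (g \<otimes> h) x = \<phi> g (\<phi> h x)"
  shows "p dvd card {x \<in> X. \<exists>g\<in>carrier G. \<phi> g x \<noteq> x}"
proof -
  let ?Y = "{x \<in> X. \<exists>g\<in>carrier G. \<phi> g x \<noteq> x}"
  let ?r = "{(x, y). x \<in> ?Y \<and> y \<in> ?Y \<and> (\<exists>g\<in>carrier G. \<phi> g x = y)}"
  have fin: "finite (carrier G)"
    using ord p by (metis card.infinite order_def power_not_zero prime_gt_0_nat less_numeral_extra(3))
  have inv_act: "\<phi> (inv g) (\<phi> g x) = x" if "g \<in> carrier G" "x \<in> X" for g x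
    using that by (metis inv_closed l_inv mult one)
  \<comment> \<open>The set of moved points is invariant: if \<open>h\<close> moves
    \<open>x\<close>, the conjugate of \<open>h\<close> by \<open>g\<close> moves the translate of
    \<open>x\<close> by \<open>g\<close>.\<close>
  have moved: "\<phi> g x \<in> ?Y" if g: "g \<in> carrier G" and x: "x \<in> ?Y" for g x
  proof -
    obtain h where h: "h \<in> carrier G" "\<phi> h x \<noteq> x" using x by auto
    have "\<phi> (g \<otimes> h \<otimes> inv g) (\<phi> g x) \<noteq> \<phi> g x"
    proof
      assume "\<phi> (g \<otimes> h \<otimes> inv g) (\<phi> g x) = \<phi> g x"
      then have "\<phi> g (\<phi> h x) = \<phi> g x"
        using g h x by (simp add: mult closed inv_act)
      then have "\<phi> h x = x" using g h x inv_act closed by (metis (no_types, lifting) mem_Collect_eq)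
      then show False using h by simp
    qed
    then show ?thesis using g h x closed by blast
  qed
  have equiv: "equiv ?Y ?r"
  proof (rule equivI)
    show "?r \<subseteq> ?Y \<times> ?Y" by auto
    show "refl_on ?Y ?r" by (rule refl_onI) (use one in blast)
    show "sym ?r"
      by (rule symI) (use inv_act inv_closed in \<open>fastforce\<close>)
    show "trans ?r"
    proof (rule transI)
      fix x y z assume "(x, y) \<in> ?r" "(y, z) \<in> ?r"
      then obtain g h where "g \<in> carrier G" "h \<in> carrier G" "\<phi> g x = y" "\<phi> h y = z" "x \<in> ?Y" "z \<in> ?Y"
        by auto
      moreover from this have "\<phi> (h \<otimes> g) x = z" by (simp add: mult)
      ultimately show "(x, z) \<in> ?r" by blast
    qed
  qed
  have class_dvd: "p dvd card C" if C: "C \<in> ?Y // ?r" for C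
  proof -
    obtain x where x: "x \<in> ?Y" "C = ?r `` {x}" using C by (elim quotientE)
    have C: "C = (\<lambda>g. \<phi> g x) ` carrier G"
      using x moved by auto
    have "card C dvd p ^ k"
      unfolding C ord[symmetric]
      by (rule card_orbit_dvd) (use x fin in \<open>auto simp: one mult inv_act closed\<close>)
    then obtain i where i: "card C = p ^ i" using p by (auto simp: divides_primepow_nat)
    have "x \<in> C" using one[of x] x(1) unfolding C by (intro image_eqI[of _ _ \<one>]) auto
    moreover have "\<exists>g\<in>carrier G. \<phi> g x \<noteq> x" using x by auto
    ultimately have "card C \<noteq> 1"
      unfolding C by (metis (no_types, lifting) card_1_singletonE image_eqI singletonD)
    then show ?thesis using i by (cases i) auto
  qed
  have "finite ?Y" using X by simp
  then show ?thesis using equiv class_dvd by (rule equiv_imp_dvd_card)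
qed

section \<open>Fixed points on cosets, and their consequences for p-groups\<close>

definition conj_set :: "('a, 'b) monoid_scheme \<Rightarrow> 'a \<Rightarrow> 'a set \<Rightarrow> 'a set" where
  "conj_set G g A = (\<lambda>x. g \<otimes>\<^bsub>G\<^esub> x \<otimes>\<^bsub>G\<^esub> inv\<^bsub>G\<^esub> g) ` A"

text \<open>Turns a fixed point of the coset action into a conjugation: if
  \<open>S x g = S x\<close>, then \<open>x g\<close> lies in \<open>S x\<close>, so the conjugate
  of \<open>g\<close> by \<open>x\<close> lies in \<open>S\<close>.\<close>

lemma (in group) rcoset_fixed_imp_conj:
  assumes R: "subgroup R G" and S: "subgroup S G" and x: "x \<in> carrier G"
    and fixed: "\<And>g. g \<in> R \<Longrightarrow> S #> x #> inv g = S #> x"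
  shows "conj_set G x R \<subseteq> S"
proof -
  have "x \<otimes> g \<otimes> inv x \<in> S" if g: "g \<in> R" for g
  proof -
    have gc: "g \<in> carrier G" using g R by (auto dest: subgroup.subset)
    have "S #> x #> g = S #> x"
      using fixed[OF subgroup.m_inv_closed[OF R g]] gc by simp
    then have "x \<otimes> g \<in> S #> x"
      using rcos_self[OF _ S, of "x \<otimes> g"] x gc S subgroup.subset[OF S] by (simp add: coset_mult_assoc)
    then show ?thesis
      using subgroup.rcos_module_imp[OF S is_group] x gc by auto
  qed
  then show ?thesis by (auto simp: conj_set_def)
qed

text \<open>Multiplying right cosets by \<open>inv g\<close> instead of \<open>g\<close> turns the
  natural right action of \<open>R\<close> into a left action.\<close>

lemma (in group) moved_rcosets_dvd:
  assumes p: "prime p" and R: "subgroup R G" "card R = p ^ k" and S: "subgroup S G"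
    and fin: "finite (carrier G)"
  shows "p dvd card {C \<in> rcosets S. \<exists>g\<in>R. C #> inv g \<noteq> C}"
proof -
  interpret R: group "G\<lparr>carrier := R\<rparr>" using R(1) by (rule subgroup.subgroup_is_group) (rule is_group)
  have sub: "R \<subseteq> carrier G" "S \<subseteq> carrier G" using R S by (auto dest: subgroup.subset)
  have "p dvd card {C \<in> rcosets S. \<exists>g\<in>carrier (G\<lparr>carrier := R\<rparr>). C #> inv g \<noteq> C}"
  proof (rule R.p_group_moved_points[OF p])
    show "order (G\<lparr>carrier := R\<rparr>) = p ^ k" using R by (simp add: order_def)
    show "finite (rcosets S)" using fin by (auto simp: RCOSETS_def)
    fix C assume C: "C \<in> rcosets S"
    then obtain x where x: "x \<in> carrier G" "C = S #> x" by (auto simp: RCOSETS_def)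
    show "C #> inv \<one>\<^bsub>G\<lparr>carrier := R\<rparr>\<^esub> = C" using x sub r_coset_subset_G[of S x] by simp
    fix g assume g: "g \<in> carrier (G\<lparr>carrier := R\<rparr>)"
    then have gc: "g \<in> carrier G" using sub by auto
    show "C #> inv g \<in> rcosets S" using x gc sub by (simp add: coset_mult_assoc rcosetsI)
    fix h assume "h \<in> carrier (G\<lparr>carrier := R\<rparr>)"
    then have hc: "h \<in> carrier G" using sub by auto
    show "C #> inv (g \<otimes>\<^bsub>G\<lparr>carrier := R\<rparr>\<^esub> h) = C #> inv h #> inv g"
      using x gc hc sub by (simp add: coset_mult_assoc inv_mult_group m_assoc)
  qed
  then show ?thesis by simp
qed

text \<open>If all cosets of \<open>S\<close> were moved by \<open>R\<close>, their number would be
  divisible by \<open>p\<close>.\<close>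

lemma (in group) p_subgroup_conj_into:
  assumes p: "prime p" and R: "subgroup R G" "card R = p ^ k" and S: "subgroup S G"
    and fin: "finite (carrier G)" and index: "\<not> p dvd card (rcosets S)"
  shows "\<exists>x\<in>carrier G. conj_set G x R \<subseteq> S"
proof -
  have "{C \<in> rcosets S. \<exists>g\<in>R. C #> inv g \<noteq> C} \<noteq> rcosets S"
    using moved_rcosets_dvd[OF p R S fin] index by metis
  then obtain C where "C \<in> rcosets S" "\<And>g. g \<in> R \<Longrightarrow> C #> inv g = C" by blast
  moreover from this obtain x where "x \<in> carrier G" "C = S #> x" by (auto simp: RCOSETS_def)
  ultimately show ?thesis using rcoset_fixed_imp_conj[OF R(1) S] by blast
qed

text \<open>Let \<open>S\<close> act on its own cosets. The index is a positive power of
  \<open>p\<close>, so the number of fixed cosets is a multiple of \<open>p\<close>; as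
  \<open>S\<close> itself is fixed, there is a second fixed coset.\<close>

lemma (in group) p_group_normalizer_grows:
  assumes p: "prime p" and ord: "order G = p ^ n" and S: "subgroup S G" "S \<noteq> carrier G"
    and fin: "finite (carrier G)"
  shows "\<exists>x\<in>carrier G - S. conj_set G x S \<subseteq> S"
proof -
  have lag: "card (rcosets S) * card S = p ^ n" using lagrange[OF S(1)] ord by simp
  then obtain k where k: "card S = p ^ k" using p by (metis divides_primepow_nat dvd_triv_right)
  obtain i where i: "card (rcosets S) = p ^ i" using p lag by (metis divides_primepow_nat dvd_triv_left)
  have "card S < card (carrier G)"
    using S fin subgroup.subset[OF S(1)] by (intro psubset_card_mono) auto
  then have "i \<noteq> 0" using i lag ord by (intro notI) (simp add: order_def)
  then have pd: "p dvd card (rcosets S)" using i by simp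
  let ?M = "{C \<in> rcosets S. \<exists>g\<in>S. C #> inv g \<noteq> C}"
  have finc: "finite (rcosets S)" using fin by (auto simp: RCOSETS_def)
  have "card (rcosets S - ?M) = card (rcosets S) - card ?M"
    by (rule card_Diff_subset) (use finc in auto)
  then have "p dvd card (rcosets S - ?M)"
    using moved_rcosets_dvd[OF p S(1) k S(1) fin] pd by (simp add: dvd_diff_nat)
  moreover have "S \<in> rcosets S - ?M"
    using S(1) subgroup.subset[OF S(1)] subgroup.m_inv_closed[OF S(1)]
    by (auto simp: subgroup.subgroup_in_rcosets[OF S(1) is_group] subgroup.rcos_const[OF S(1) is_group])
  ultimately have "rcosets S - ?M \<noteq> {S}"
    using p by (metis card_1_singleton_iff is_singleton_def nat_dvd_1_iff_1 not_prime_1 One_nat_def)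
  then obtain C where C: "C \<in> rcosets S - ?M" "C \<noteq> S" using \<open>S \<in> rcosets S - ?M\<close> by blast
  then obtain x where x: "x \<in> carrier G" "C = S #> x" by (auto simp: RCOSETS_def)
  then have "x \<notin> S" using C subgroup.rcos_const[OF S(1) is_group] by auto
  moreover have "conj_set G x S \<subseteq> S"
    by (rule rcoset_fixed_imp_conj[OF S(1) S(1) x(1)]) (use C x in auto)
  ultimately show ?thesis using x by auto
qed

text \<open>The fixed points of the conjugation action form the center. Their number is divisible by
  \<open>p\<close>, and the identity is one of them.\<close>

lemma (in group) p_group_center_nontrivial:
  assumes p: "prime p" and ord: "order G = p ^ n" "n > 0" and fin: "finite (carrier G)"
  shows "\<exists>z\<in>center_of G (carrier G). z \<noteq> \<one>"
proof -
  let ?M = "{x \<in> carrier G. \<exists>g\<in>carrier G. g \<otimes> x \<otimes> inv g \<noteq> x}"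
  have "p dvd card ?M"
    by (rule p_group_moved_points[OF p ord(1) fin]) (auto simp: m_assoc inv_mult_group)
  moreover have "p dvd card (carrier G)" using ord by (simp add: order_def)
  moreover have "card (carrier G - ?M) = card (carrier G) - card ?M"
    by (rule card_Diff_subset) (use fin in auto)
  ultimately have "p dvd card (carrier G - ?M)" by (simp add: dvd_diff_nat)
  then have "carrier G - ?M \<noteq> {\<one>}"
    using p by (metis card_1_singleton_iff nat_dvd_1_iff_1 not_prime_1 One_nat_def)
  moreover have "\<one> \<in> carrier G - ?M" by auto
  ultimately obtain z where z: "z \<in> carrier G - ?M" "z \<noteq> \<one>" by blast
  have "z \<otimes> g = g \<otimes> z" if g: "g \<in> carrier G" for g
  proof -
    have "z = g \<otimes> z \<otimes> inv g" "z \<in> carrier G" using z g by auto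
    then show ?thesis using inv_solve_right[of z "g \<otimes> z" g] g by simp
  qed
  then show ?thesis using z by (auto simp: center_of_def)
qed

subsection \<open>Conjugation and Sylow subgroups\<close>

definition centralizer :: "('a, 'b) monoid_scheme \<Rightarrow> 'a set \<Rightarrow> 'a set" where
  "centralizer G E = {x \<in> carrier G. \<forall>y\<in>E. x \<otimes>\<^bsub>G\<^esub> y = y \<otimes>\<^bsub>G\<^esub> x}"

context group
begin

lemma conj_hom:
  assumes "g \<in> carrier G"
  shows "group_hom G G (\<lambda>x. g \<otimes> x \<otimes> inv g)"
proof -
  have "inv g \<otimes> (g \<otimes> z) = z" if "z \<in> carrier G" for z
    using that assms by (simp add: m_assoc[symmetric])
  then show ?thesis
    using assms by unfold_locales (simp add: hom_def m_assoc)
qed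

lemma inj_on_conj: "g \<in> carrier G \<Longrightarrow> inj_on (\<lambda>x. g \<otimes> x \<otimes> inv g) (carrier G)"
  by (rule inj_onI) simp

lemma conj_set_closed: "g \<in> carrier G \<Longrightarrow> A \<subseteq> carrier G \<Longrightarrow> conj_set G g A \<subseteq> carrier G"
  by (auto simp: conj_set_def)

lemma conj_set_subgroup: "g \<in> carrier G \<Longrightarrow> subgroup A G \<Longrightarrow> subgroup (conj_set G g A) G"
  unfolding conj_set_def by (rule group_hom.subgroup_img_is_subgroup[OF conj_hom])

lemma card_conj_set: "g \<in> carrier G \<Longrightarrow> A \<subseteq> carrier G \<Longrightarrow> card (conj_set G g A) = card A"
  unfolding conj_set_def by (rule card_image) (rule inj_on_subset[OF inj_on_conj])

lemma conj_set_mono: "A \<subseteq> B \<Longrightarrow> conj_set G g A \<subseteq> conj_set G g B"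
  by (auto simp: conj_set_def)

lemma conj_set_mult:
  "\<lbrakk>g \<in> carrier G; h \<in> carrier G; A \<subseteq> carrier G\<rbrakk>
    \<Longrightarrow> conj_set G (g \<otimes> h) A = conj_set G g (conj_set G h A)"
  unfolding conj_set_def image_image by (rule image_cong) (auto simp: m_assoc inv_mult_group subset_iff)

lemma conj_set_one: "A \<subseteq> carrier G \<Longrightarrow> conj_set G \<one> A = A"
  by (force simp: conj_set_def subset_iff image_iff)

lemma conj_set_inv:
  "\<lbrakk>g \<in> carrier G; A \<subseteq> carrier G\<rbrakk> \<Longrightarrow> conj_set G (inv g) (conj_set G g A) = A"
  by (simp add: conj_set_mult[symmetric] conj_set_one)

lemma conj_set_inv':
  "\<lbrakk>g \<in> carrier G; A \<subseteq> carrier G\<rbrakk> \<Longrightarrow> conj_set G g (conj_set G (inv g) A) = A"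
  by (simp add: conj_set_mult[symmetric] conj_set_one)

lemma conj_set_centralizer:
  assumes "g \<in> centralizer G E" "A \<subseteq> E" "A \<subseteq> carrier G"
  shows "conj_set G g A = A"
proof -
  have "g \<otimes> x \<otimes> inv g = x" if "x \<in> A" for x
  proof -
    have "g \<in> carrier G" "x \<in> carrier G" "g \<otimes> x = x \<otimes> g"
      using assms that by (auto simp: centralizer_def)
    then show ?thesis by (simp add: m_assoc)
  qed
  then show ?thesis by (simp add: conj_set_def)
qed

lemma conj_set_consistent:
  "subgroup H G \<Longrightarrow> x \<in> H \<Longrightarrow> conj_set (G\<lparr>carrier := H\<rparr>) x A = conj_set G x A"
  by (simp add: conj_set_def)

lemma subgroup_centralizer:
  assumes "E \<subseteq> carrier G"
  shows "subgroup (centralizer G E) G"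
proof (rule subgroupI)
  fix a assume a: "a \<in> centralizer G E"
  have "inv a \<otimes> y = y \<otimes> inv a" if y: "y \<in> E" for y
  proof -
    have *: "a \<in> carrier G" "y \<in> carrier G" "a \<otimes> y = y \<otimes> a" using a y assms by (auto simp: centralizer_def)
    then have "y = a \<otimes> y \<otimes> inv a" by (simp add: m_assoc)
    also have "\<dots> = a \<otimes> (y \<otimes> inv a)" using *(1,2) by (simp add: m_assoc)
    finally show ?thesis using inv_solve_left[of "y \<otimes> inv a" a y] *(1,2) by simp
  qed
  then show "inv a \<in> centralizer G E" using a by (auto simp: centralizer_def)
next
  fix a b assume ab: "a \<in> centralizer G E" "b \<in> centralizer G E"
  have "a \<otimes> b \<otimes> y = y \<otimes> (a \<otimes> b)" if y: "y \<in> E" for y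
  proof -
    have *: "a \<in> carrier G" "b \<in> carrier G" "y \<in> carrier G" "a \<otimes> y = y \<otimes> a" "b \<otimes> y = y \<otimes> b"
      using ab y assms by (auto simp: centralizer_def)
    have "a \<otimes> b \<otimes> y = a \<otimes> y \<otimes> b" using *(1-3,5) by (simp add: m_assoc)
    then show ?thesis using * by (simp add: m_assoc)
  qed
  then show "a \<otimes> b \<in> centralizer G E" using ab by (auto simp: centralizer_def)
qed (use assms in \<open>auto simp: centralizer_def subset_iff\<close>)

lemma subgroup_normalizer:
  assumes "M \<subseteq> carrier G"
  shows "subgroup {x \<in> carrier G. conj_set G x M = M} G"
proof (rule subgroupI)
  show "{x \<in> carrier G. conj_set G x M = M} \<noteq> {}" using conj_set_one[OF assms] by auto
  fix a assume "a \<in> {x \<in> carrier G. conj_set G x M = M}"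
  then show "inv a \<in> {x \<in> carrier G. conj_set G x M = M}" using conj_set_inv[of a M] assms by auto
qed (use assms in \<open>auto simp: conj_set_mult\<close>)

section \<open>Sylow theory relative to a subgroup\<close>

lemma sylow_subgroup_index:
  assumes p: "prime p" and fin: "finite (carrier G)" and S: "sylow_subgroup G p S"
  shows "\<not> p dvd card (rcosets S)"
proof
  assume "p dvd card (rcosets S)"
  moreover have "card (rcosets S) * p ^ multiplicity p (order G) = order G"
    using lagrange[of S] S by (simp add: sylow_subgroup_def)
  ultimately have "p ^ Suc (multiplicity p (order G)) dvd order G"
    by (metis dvd_refl mult_dvd_mono power_Suc)
  moreover have "order G \<noteq> 0" using fin order_gt_0_iff_finite by simp
  ultimately show False
    using p power_dvd_iff_le_multiplicity[of "order G" p "Suc (multiplicity p (order G))"]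
    by (simp add: prime_nat_iff)
qed

text \<open>Sylow theory is carried out inside \<open>H\<close>, but conjugation is expressed in
  \<open>G\<close>. What matters is that the conjugating element lies in \<open>H\<close>: for
  \<open>H\<close> a centralizer it then fixes the centralized subgroup.\<close>

lemma p_subgroup_conj_into_sylow:
  assumes p: "prime p" and fin: "finite (carrier G)" and H: "subgroup H G"
    and S: "sylow_subgroup (G\<lparr>carrier := H\<rparr>) p S"
    and R: "subgroup R G" "R \<subseteq> H" "card R = p ^ k"
  shows "\<exists>x\<in>H. conj_set G x R \<subseteq> S"
proof -
  interpret H: group "G\<lparr>carrier := H\<rparr>" using H is_group by (rule subgroup.subgroup_is_group)
  have finH: "finite (carrier (G\<lparr>carrier := H\<rparr>))"
    using fin subgroup.subset[OF H] by (auto intro: finite_subset)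
  have "\<exists>x\<in>carrier (G\<lparr>carrier := H\<rparr>). conj_set (G\<lparr>carrier := H\<rparr>) x R \<subseteq> S"
    by (rule H.p_subgroup_conj_into[OF p _ R(3) _ finH H.sylow_subgroup_index[OF p finH S]])
      (use S subgroup_incl[OF R(1) H R(2)] in \<open>auto simp: sylow_subgroup_def\<close>)
  then show ?thesis using H by (auto simp: conj_set_consistent)
qed

lemma sylow_subgroup_inD:
  assumes H: "subgroup H G" and S: "sylow_subgroup (G\<lparr>carrier := H\<rparr>) p S"
  shows "subgroup S G" "S \<subseteq> H" "card S = p ^ multiplicity p (card H)"
  using S incl_subgroup[OF H] subgroup.subset[of S "G\<lparr>carrier := H\<rparr>"]
  by (auto simp: sylow_subgroup_def order_def)

lemma sylow_subgroup_exists: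
  assumes "prime p" "finite (carrier G)"
  shows "\<exists>S. sylow_subgroup G p S"
proof -
  obtain m where "order G = p ^ multiplicity p (order G) * m"
    using multiplicity_dvd[of p "order G"] by (auto elim: dvdE)
  then show ?thesis using sylow_thm[OF assms(1) is_group _ assms(2)] unfolding sylow_subgroup_def by blast
qed

lemma sylow_conj:
  assumes "sylow_subgroup G p S" "x \<in> carrier G"
  shows "sylow_subgroup G p (conj_set G x S)"
  using assms conj_set_subgroup[of x S] card_conj_set[of x S] subgroup.subset[of S G]
  by (auto simp: sylow_subgroup_def)

lemma sylow_in_conj:
  assumes H: "subgroup H G" and "sylow_subgroup (G\<lparr>carrier := H\<rparr>) p S" "x \<in> H"
  shows "sylow_subgroup (G\<lparr>carrier := H\<rparr>) p (conj_set G x S)"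
proof -
  interpret H: group "G\<lparr>carrier := H\<rparr>" using H is_group by (rule subgroup.subgroup_is_group)
  show ?thesis using H.sylow_conj[of p S x] assms by (simp add: conj_set_consistent)
qed

lemma p_subgroup_le_sylow_in:
  assumes p: "prime p" and fin: "finite (carrier G)" and H: "subgroup H G"
    and R: "subgroup R G" "R \<subseteq> H" "card R = p ^ k"
    and S0: "sylow_subgroup (G\<lparr>carrier := H\<rparr>) p S0"
  shows "\<exists>x\<in>H. R \<subseteq> conj_set G x S0"
proof -
  obtain x where x: "x \<in> H" "conj_set G x R \<subseteq> S0"
    using p_subgroup_conj_into_sylow[OF p fin H S0 R] by blast
  have xc: "x \<in> carrier G" using x subgroup.subset[OF H] by auto
  have "R \<subseteq> conj_set G (inv x) S0"
    using conj_set_mono[OF x(2), of "inv x"] conj_set_inv[OF xc] subgroup.subset[OF R(1)] by simp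
  then show ?thesis using subgroup.m_inv_closed[OF H x(1)] by blast
qed

lemma p_subgroup_le_some_sylow_in:
  assumes p: "prime p" and fin: "finite (carrier G)" and H: "subgroup H G"
    and R: "subgroup R G" "R \<subseteq> H" "card R = p ^ k"
  shows "\<exists>S. sylow_subgroup (G\<lparr>carrier := H\<rparr>) p S \<and> R \<subseteq> S"
proof -
  interpret H: group "G\<lparr>carrier := H\<rparr>" using H is_group by (rule subgroup.subgroup_is_group)
  obtain S0 where S0: "sylow_subgroup (G\<lparr>carrier := H\<rparr>) p S0"
    using H.sylow_subgroup_exists[OF p] fin subgroup.subset[OF H] by (auto intro: finite_subset)
  show ?thesis
    using p_subgroup_le_sylow_in[OF p fin H R S0] sylow_in_conj[OF H S0] by blast
qed

lemma p_subgroup_le_sylow: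
  assumes "prime p" "finite (carrier G)" "subgroup R G" "card R = p ^ k"
  shows "\<exists>S. sylow_subgroup G p S \<and> R \<subseteq> S"
  using p_subgroup_le_some_sylow_in[OF assms(1,2) subgroup_self assms(3) _ assms(4)] subgroup.subset[OF assms(3)]
  by simp

lemma sylow_in_conjugate:
  assumes p: "prime p" and fin: "finite (carrier G)" and H: "subgroup H G"
    and S: "sylow_subgroup (G\<lparr>carrier := H\<rparr>) p S" and T: "sylow_subgroup (G\<lparr>carrier := H\<rparr>) p T"
  shows "\<exists>x\<in>H. conj_set G x S = T"
proof -
  note SD = sylow_subgroup_inD[OF H S] and TD = sylow_subgroup_inD[OF H T]
  obtain x where x: "x \<in> H" "conj_set G x S \<subseteq> T"
    using p_subgroup_conj_into_sylow[OF p fin H T SD] by blast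
  have "card (conj_set G x S) = card T"
    using card_conj_set[of x S] x(1) subgroup.subset[OF H] subgroup.subset[OF SD(1)] SD TD by auto
  moreover have "finite T" using fin subgroup.subset[OF TD(1)] by (rule rev_finite_subset)
  ultimately show ?thesis using x card_subset_eq by blast
qed

text \<open>The multiplicities of \<open>p\<close> in the orders of \<open>H\<close> and
  \<open>G\<close> agree: one inequality because \<open>card H\<close> divides
  \<open>order G\<close>, the other because \<open>card Q\<close> divides
  \<open>card H\<close>.\<close>

lemma sylow_restrict:
  assumes p: "prime p" and fin: "finite (carrier G)" and H: "subgroup H G"
    and Q: "sylow_subgroup G p Q" "Q \<subseteq> H"
  shows "sylow_subgroup (G\<lparr>carrier := H\<rparr>) p Q"
proof -
  interpret H: group "G\<lparr>carrier := H\<rparr>" using H is_group by (rule subgroup.subgroup_is_group)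
  have sub: "subgroup Q (G\<lparr>carrier := H\<rparr>)" using subgroup_incl[OF _ H Q(2)] Q(1) by (simp add: sylow_subgroup_def)
  have pos: "order G \<noteq> 0" "card H \<noteq> 0"
    using fin H subgroup.subset[OF H] subgroup.one_closed[OF H]
    by (auto simp: order_def card_eq_0_iff dest: finite_subset)
  have unit: "\<not> is_unit p" using p by (simp add: prime_nat_iff)
  have "card H dvd order G" using lagrange[OF H] by (metis dvd_triv_right)
  then have 1: "multiplicity p (card H) \<le> multiplicity p (order G)"
    using pos(1) by (intro dvd_imp_multiplicity_le)
  have "card Q dvd card H" using H.lagrange[OF sub] by (simp add: order_def) (metis dvd_triv_right)
  then have "multiplicity p (order G) \<le> multiplicity p (card H)"
    using Q(1) pos(2) unit by (intro multiplicity_geI) (auto simp: sylow_subgroup_def)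
  with 1 sub Q(1) show ?thesis by (simp add: sylow_subgroup_def order_def)
qed

end

subsection \<open>Elementary abelian subgroups\<close>

text \<open>This is \<open>\<Omega>\<^sub>1(Z(Q))\<close> as an explicit set: in an abelian group
  the elements with trivial \<open>p\<close>-th power already form a subgroup. The agreement with
  the generated subgroup is \<open>Omega1_center_of\<close>.\<close>

definition Omega_center :: "('a, 'b) monoid_scheme \<Rightarrow> nat \<Rightarrow> 'a set \<Rightarrow> 'a set" where
  "Omega_center G p Q = {x \<in> center_of G Q. x [^]\<^bsub>G\<^esub> p = \<one>\<^bsub>G\<^esub>}"

lemma Omega_center_subset: "Omega_center G p Q \<subseteq> Q"
  by (auto simp: Omega_center_def center_of_def)

context group
begin

lemma conj_mult:
  assumes "g \<in> carrier G" "x \<in> carrier G" "y \<in> carrier G"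
  shows "(g \<otimes> x \<otimes> inv g) \<otimes> (g \<otimes> y \<otimes> inv g) = g \<otimes> (x \<otimes> y) \<otimes> inv g"
  using hom_mult[OF group_hom.homh[OF conj_hom[OF assms(1)]] assms(2,3)] by simp

lemma conj_pow:
  assumes "g \<in> carrier G" "x \<in> carrier G"
  shows "(g \<otimes> x \<otimes> inv g) [^] (n::nat) = g \<otimes> x [^] n \<otimes> inv g"
  using group_hom.hom_nat_pow[OF conj_hom[OF assms(1)] assms(2), of n] by simp

lemma elem_ab_carrier: "elem_ab G p E \<Longrightarrow> E \<subseteq> carrier G"
  by (auto simp: elem_ab_def dest: subgroup.subset)

lemma elem_ab_conj:
  assumes g: "g \<in> carrier G" and E: "elem_ab G p E"
  shows "elem_ab G p (conj_set G g E)"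
  unfolding elem_ab_def
proof (intro conjI ballI)
  have sub: "E \<subseteq> carrier G" using E by (rule elem_ab_carrier)
  show "subgroup (conj_set G g E) G" using g E by (auto simp: elem_ab_def conj_set_subgroup)
  fix x assume "x \<in> conj_set G g E"
  then obtain a where a: "a \<in> E" "x = g \<otimes> a \<otimes> inv g" by (auto simp: conj_set_def)
  show "x [^] p = \<one>" using a g sub E by (auto simp: conj_pow subset_iff elem_ab_def)
  fix y assume "y \<in> conj_set G g E"
  then obtain b where b: "b \<in> E" "y = g \<otimes> b \<otimes> inv g" by (auto simp: conj_set_def)
  have "a \<otimes> b = b \<otimes> a" using a b E by (auto simp: elem_ab_def)
  then show "x \<otimes> y = y \<otimes> x" using a b g sub by (simp add: conj_mult subset_iff)
qed

lemma card_subgroup_prime_power: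
  assumes p: "prime p" and D: "subgroup D G" and Q: "subgroup Q G" "D \<subseteq> Q" "card Q = p ^ m"
  shows "\<exists>k. card D = p ^ k"
proof -
  interpret Q: group "G\<lparr>carrier := Q\<rparr>" using Q(1) is_group by (rule subgroup.subgroup_is_group)
  have "card D dvd p ^ m"
    using Q.lagrange[OF subgroup_incl[OF D Q(1,2)]] Q(3) by (simp add: order_def) (metis dvd_triv_right)
  then show ?thesis using p by (auto simp: divides_primepow_nat)
qed

text \<open>By Cauchy, every prime \<open>q\<close> dividing the order yields a non-trivial element
  killed by \<open>q\<close>. It is also killed by \<open>p\<close>, so
  \<open>q = p\<close>.\<close>

lemma card_elem_ab:
  assumes p: "prime p" and fin: "finite (carrier G)" and E: "elem_ab G p E"
  shows "\<exists>k. card E = p ^ k"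
proof -
  have sub: "subgroup E G" using E by (simp add: elem_ab_def)
  interpret E: group "G\<lparr>carrier := E\<rparr>" using sub is_group by (rule subgroup.subgroup_is_group)
  have finE: "finite E" using fin subgroup.subset[OF sub] by (rule rev_finite_subset)
  then have pos: "card E \<noteq> 0" using subgroup.one_closed[OF sub] by auto
  have "q = p" if q: "q \<in> prime_factors (card E)" for q
  proof -
    have qp: "prime q" "q dvd card E" using q by auto
    \<comment> \<open>With exponent 1, Sylow's theorem becomes Cauchy's theorem: there is a subgroup
      of order \<open>q\<close>.\<close>
    then obtain m where "card E = q ^ 1 * m" by (auto elim: dvdE)
    then obtain H where H: "subgroup H (G\<lparr>carrier := E\<rparr>)" "card H = q ^ 1"
      using sylow_thm[OF qp(1) E.is_group, of 1 m] finE by (auto simp: order_def)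
    have HG: "subgroup H G" "H \<subseteq> E"
      using incl_subgroup[OF sub H(1)] subgroup.subset[OF H(1)] by auto
    have "H \<noteq> {\<one>}" using H(2) qp(1) by auto
    then obtain x where x: "x \<in> H" "x \<noteq> \<one>" using subgroup.one_closed[OF HG(1)] by auto
    have xc: "x \<in> carrier G" using x HG subgroup.subset by blast
    interpret H: group "G\<lparr>carrier := H\<rparr>" using HG(1) is_group by (rule subgroup.subgroup_is_group)
    have "x [^]\<^bsub>G\<lparr>carrier := H\<rparr>\<^esub> order (G\<lparr>carrier := H\<rparr>) = \<one>\<^bsub>G\<lparr>carrier := H\<rparr>\<^esub>"
      by (rule H.pow_order_eq_1) (use x in auto)
    then have "x [^] q = \<one>" using H(2) nat_pow_consistent[of x q H] by (simp add: order_def)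
    then have 1: "ord x dvd q" using xc by (simp add: pow_eq_id)
    have "x [^] p = \<one>" using E x HG by (auto simp: elem_ab_def)
    then have 2: "ord x dvd p" using xc by (simp add: pow_eq_id)
    have "ord x \<noteq> 1" using x xc ord_eq_1 by blast
    then show "q = p" using 1 2 p qp(1) by (auto simp: prime_nat_iff)
  qed
  then have "prime_factors (card E) \<subseteq> {p}" by auto
  \<comment> \<open>If \<open>p\<close> is not a prime factor, there are no prime factors at all, so
    \<open>E\<close> is trivial and the exponent is 0.\<close>
  then have "card E = p ^ multiplicity p (card E)"
    using prime_factorization_nat[of "card E"] pos p
    by (cases "p \<in> prime_factors (card E)")
      (auto simp: subset_singleton_iff prime_factors_multiplicity)
  then show ?thesis by blast
qed

text \<open>Everything follows from interchanging the two middle factors of a product of four, which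
  is the fact \<open>swap\<close>.\<close>

lemma elem_ab_set_mult:
  assumes A: "elem_ab G p A" and B: "elem_ab G p B"
    and comm: "\<And>x y. x \<in> A \<Longrightarrow> y \<in> B \<Longrightarrow> x \<otimes> y = y \<otimes> x"
  shows "elem_ab G p (A <#> B)" "A \<subseteq> A <#> B" "B \<subseteq> A <#> B"
proof -
  have sA: "subgroup A G" and sB: "subgroup B G" using A B by (auto simp: elem_ab_def)
  have cA: "x \<in> carrier G" if "x \<in> A" for x using that sA subgroup.mem_carrier by metis
  have cB: "x \<in> carrier G" if "x \<in> B" for x using that sB subgroup.mem_carrier by metis
  have swap: "(a \<otimes> b) \<otimes> (a' \<otimes> b') = (a \<otimes> a') \<otimes> (b \<otimes> b')"
    if "a \<in> A" "a' \<in> A" "b \<in> B" "b' \<in> B" for a a' b b'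
  proof -
    have "(a \<otimes> b) \<otimes> (a' \<otimes> b') = a \<otimes> (b \<otimes> a') \<otimes> b'" using that by (simp add: m_assoc cA cB)
    also have "b \<otimes> a' = a' \<otimes> b" using comm[OF that(2,3)] by simp
    finally show ?thesis using that by (simp add: m_assoc cA cB)
  qed
  have memI: "a \<otimes> b \<in> A <#> B" if "a \<in> A" "b \<in> B" for a b using that by (auto simp: set_mult_def)
  have memE: "\<exists>a b. a \<in> A \<and> b \<in> B \<and> x = a \<otimes> b" if "x \<in> A <#> B" for x
    using that by (auto simp: set_mult_def)
  have pow: "(a \<otimes> b) [^] n = a [^] n \<otimes> b [^] n" if "a \<in> A" "b \<in> B" for a b and n :: nat
    using pow_mult_distrib[OF comm[OF that]] that cA cB by simp
  show "elem_ab G p (A <#> B)"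
    unfolding elem_ab_def
  proof (intro conjI ballI subgroupI)
    show "A <#> B \<subseteq> carrier G" using cA cB by (auto simp: set_mult_def)
    show "A <#> B \<noteq> {}"
      using memI[OF subgroup.one_closed[OF sA] subgroup.one_closed[OF sB]] by blast
  next
    fix x assume "x \<in> A <#> B"
    then obtain a b where ab: "a \<in> A" "b \<in> B" "x = a \<otimes> b" using memE by blast
    then have "inv x = inv a \<otimes> inv b"
      using comm[OF subgroup.m_inv_closed[OF sA ab(1)] subgroup.m_inv_closed[OF sB ab(2)]] by (simp add: inv_mult_group cA cB)
    then show "inv x \<in> A <#> B"
      using memI[OF subgroup.m_inv_closed[OF sA ab(1)] subgroup.m_inv_closed[OF sB ab(2)]] by simp
  next
    fix x y assume "x \<in> A <#> B" "y \<in> A <#> B"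
    then obtain a b c d where *: "a \<in> A" "b \<in> B" "x = a \<otimes> b" "c \<in> A" "d \<in> B" "y = c \<otimes> d"
      using memE by metis
    show "x \<otimes> y \<in> A <#> B"
      using * swap[OF *(1,4,2,5)] memI subgroup.m_closed[OF sA] subgroup.m_closed[OF sB] by simp
    have "a \<otimes> c = c \<otimes> a" "b \<otimes> d = d \<otimes> b" using * A B by (auto simp: elem_ab_def)
    then show "x \<otimes> y = y \<otimes> x"
      using * swap[OF *(1,4,2,5)] swap[OF *(4,1,5,2)] by simp
  next
    fix x assume "x \<in> A <#> B"
    then obtain a b where ab: "a \<in> A" "b \<in> B" "x = a \<otimes> b" using memE by blast
    then show "x [^] p = \<one>" using pow[OF ab(1,2)] A B by (simp add: elem_ab_def)
  qed
  show "A \<subseteq> A <#> B" "B \<subseteq> A <#> B"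
    using memI[OF _ subgroup.one_closed[OF sB]] memI[OF subgroup.one_closed[OF sA]] cA cB
    by (metis r_one subsetI, metis l_one subsetI)
qed

lemma subgroup_center_of: "subgroup Q G \<Longrightarrow> subgroup (center_of G Q) G"
proof -
  assume Q: "subgroup Q G"
  have "center_of G Q = Q \<inter> centralizer G Q"
    using subgroup.subset[OF Q] by (auto simp: center_of_def centralizer_def)
  then show ?thesis
    using subgroups_Inter_pair[OF Q subgroup_centralizer] subgroup.subset[OF Q] by simp
qed

lemma elem_ab_Omega_center:
  assumes Q: "subgroup Q G"
  shows "elem_ab G p (Omega_center G p Q)"
proof -
  note Z = subgroup_center_of[OF Q]
  have c: "x \<in> carrier G" if "x \<in> center_of G Q" for x using subgroup.mem_carrier[OF Z that] .
  have comm: "x \<otimes> y = y \<otimes> x" if "x \<in> center_of G Q" "y \<in> center_of G Q" for x y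
    using that unfolding center_of_def by blast
  show ?thesis
    unfolding elem_ab_def
  proof (intro conjI ballI subgroupI)
    show "Omega_center G p Q \<subseteq> carrier G" using c by (auto simp: Omega_center_def)
    show "Omega_center G p Q \<noteq> {}"
      using subgroup.one_closed[OF Z] by (auto simp: Omega_center_def)
  next
    fix x assume "x \<in> Omega_center G p Q"
    then show "inv x \<in> Omega_center G p Q"
      using subgroup.m_inv_closed[OF Z] c by (auto simp: Omega_center_def nat_pow_inv)
  next
    fix x y assume "x \<in> Omega_center G p Q" "y \<in> Omega_center G p Q"
    then show "x \<otimes> y \<in> Omega_center G p Q"
      using subgroup.m_closed[OF Z] c pow_mult_distrib[OF comm] by (auto simp: Omega_center_def)
  next
    fix x y assume "x \<in> Omega_center G p Q" "y \<in> Omega_center G p Q"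
    then show "x \<otimes> y = y \<otimes> x" using comm unfolding Omega_center_def by blast
  qed (auto simp: Omega_center_def)
qed

lemma Omega_center_conj:
  assumes Q: "subgroup Q G" and g: "g \<in> carrier G"
  shows "Omega_center G p (conj_set G g Q) = conj_set G g (Omega_center G p Q)"
proof -
  \<comment> \<open>One inclusion for arbitrary \<open>S\<close> and \<open>h\<close> is enough: the
    reverse one is the same statement for the conjugate of \<open>Q\<close> and the inverse of
    \<open>g\<close>.\<close>
  have sub: "conj_set G h (Omega_center G p S) \<subseteq> Omega_center G p (conj_set G h S)"
    if S: "subgroup S G" and h: "h \<in> carrier G" for S h
  proof
    fix x assume "x \<in> conj_set G h (Omega_center G p S)"
    then obtain a where a: "a \<in> Omega_center G p S" "x = h \<otimes> a \<otimes> inv h" by (auto simp: conj_set_def)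
    have aS: "a \<in> S" by (rule subsetD[OF Omega_center_subset a(1)])
    have ac: "a \<in> carrier G" using aS subgroup.mem_carrier[OF S] by blast
    have "x \<otimes> y = y \<otimes> x" if "y \<in> conj_set G h S" for y
    proof -
      from that obtain b where b: "b \<in> S" "y = h \<otimes> b \<otimes> inv h" by (auto simp: conj_set_def)
      have bc: "b \<in> carrier G" using b(1) subgroup.mem_carrier[OF S] by blast
      have "a \<otimes> b = b \<otimes> a" using a(1) b(1) unfolding Omega_center_def center_of_def by blast
      then show ?thesis unfolding a(2) b(2) conj_mult[OF h ac bc] conj_mult[OF h bc ac] by simp
    qed
    moreover have "x \<in> conj_set G h S" using a aS by (auto simp: conj_set_def)
    moreover have "x [^] p = \<one>"
      using a(1) h ac unfolding a(2) by (simp add: conj_pow Omega_center_def)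
    ultimately show "x \<in> Omega_center G p (conj_set G h S)"
      unfolding Omega_center_def center_of_def by blast
  qed
  have Qc: "Q \<subseteq> carrier G" using subgroup.subset[OF Q] .
  have "conj_set G (inv g) (Omega_center G p (conj_set G g Q)) \<subseteq> Omega_center G p Q"
    using sub[OF conj_set_subgroup[OF g Q] inv_closed[OF g]] conj_set_inv[OF g Qc] by simp
  then have "conj_set G g (conj_set G (inv g) (Omega_center G p (conj_set G g Q)))
      \<subseteq> conj_set G g (Omega_center G p Q)" by (rule conj_set_mono)
  moreover have "Omega_center G p (conj_set G g Q) \<subseteq> carrier G"
    by (rule order_trans[OF Omega_center_subset conj_set_closed[OF g Qc]])
  ultimately show ?thesis using sub[OF Q g] conj_set_inv'[OF g] by auto
qed

end

subsection \<open>Sylow conjugacy when the rank gap is at most one\<close>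

text \<open>The rank condition is recast in terms of orders, uniformly over all Sylow subgroups.
  Positivity of \<open>r\<close> makes every \<open>\<Omega>\<^sub>Q\<close> non-trivial and hence
  an element of the poset.\<close>

locale p_rank_gap = group G for G (structure) +
  fixes p r :: nat
  assumes finite_carrier: "finite (carrier G)"
    and prime_p: "prime p"
    and r_pos: "r > 0"
    and card_Omega_center: "sylow_subgroup G p Q \<Longrightarrow> card (Omega_center G p Q) = p ^ r"
    and card_elem_ab_le: "elem_ab G p E \<Longrightarrow> card E \<le> p ^ Suc r"
begin

text \<open>Largest by order, not by inclusion: if the p-rank of \<open>G\<close> is
  \<open>r\<close>, there are none.\<close>

definition maximal :: "'a set \<Rightarrow> bool" where
  "maximal M \<longleftrightarrow> elem_ab G p M \<and> card M = p ^ Suc r"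

definition central_type :: "'a set \<Rightarrow> bool" where
  "central_type E \<longleftrightarrow> (\<exists>Q. sylow_subgroup G p Q \<and> E \<subseteq> Omega_center G p Q)"

lemma p_gt_1: "p > 1"
  using prime_p by (rule prime_gt_1_nat)

lemma finite_subgroup: "subgroup H G \<Longrightarrow> finite H"
  using finite_carrier subgroup.subset by (rule rev_finite_subset)

lemma sylowD:
  assumes "sylow_subgroup G p Q"
  shows "subgroup Q G" "card Q = p ^ multiplicity p (order G)" "Q \<subseteq> carrier G"
    "elem_ab G p (Omega_center G p Q)" "Omega_center G p Q \<subseteq> carrier G"
proof -
  show Q: "subgroup Q G" "card Q = p ^ multiplicity p (order G)" using assms by (auto simp: sylow_subgroup_def)
  show "Q \<subseteq> carrier G" using subgroup.subset[OF Q(1)] .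
  show W: "elem_ab G p (Omega_center G p Q)" using elem_ab_Omega_center[OF Q(1)] .
  show "Omega_center G p Q \<subseteq> carrier G" using elem_ab_carrier[OF W] .
qed

lemma Omega_center_commute:
  "x \<in> Omega_center G p Q \<Longrightarrow> y \<in> Q \<Longrightarrow> x \<otimes> y = y \<otimes> x"
  unfolding Omega_center_def center_of_def by blast

lemma maximalD:
  assumes "maximal M"
  shows "elem_ab G p M" "subgroup M G" "card M = p ^ Suc r" "M \<subseteq> carrier G"
    "\<And>x y. x \<in> M \<Longrightarrow> y \<in> M \<Longrightarrow> x \<otimes> y = y \<otimes> x"
proof -
  show M: "elem_ab G p M" "card M = p ^ Suc r" using assms by (auto simp: maximal_def)
  show "subgroup M G" using M by (simp add: elem_ab_def)
  show "M \<subseteq> carrier G" using elem_ab_carrier[OF M(1)] .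
  show "x \<otimes> y = y \<otimes> x" if "x \<in> M" "y \<in> M" for x y using M(1) that unfolding elem_ab_def by blast
qed

lemma maximal_conj:
  assumes "g \<in> carrier G" "maximal M"
  shows "maximal (conj_set G g M)"
  unfolding maximal_def
  using elem_ab_conj[OF assms(1) maximalD(1)[OF assms(2)]] card_conj_set[OF assms(1) maximalD(4)[OF assms(2)]]
    maximalD(3)[OF assms(2)] by simp

lemma central_type_conj:
  assumes g: "g \<in> carrier G" and E: "central_type E"
  shows "central_type (conj_set G g E)"
proof -
  obtain Q where Q: "sylow_subgroup G p Q" "E \<subseteq> Omega_center G p Q" using E by (auto simp: central_type_def)
  then have "conj_set G g E \<subseteq> Omega_center G p (conj_set G g Q)"
    using conj_set_mono[OF Q(2)] Omega_center_conj[OF sylowD(1)[OF Q(1)] g] by simp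
  then show ?thesis using sylow_conj[OF Q(1) g] by (auto simp: central_type_def)
qed

text \<open>The product \<open>A <#> M\<close> is elementary abelian, hence no larger than
  \<open>M\<close>.\<close>

lemma maximal_absorbs:
  assumes M: "maximal M" and A: "elem_ab G p A"
    and comm: "\<And>x y. x \<in> A \<Longrightarrow> y \<in> M \<Longrightarrow> x \<otimes> y = y \<otimes> x"
  shows "A \<subseteq> M"
proof -
  note * = elem_ab_set_mult[OF A maximalD(1)[OF M] comm]
  have "finite (A <#> M)" using finite_subgroup *(1) by (auto simp: elem_ab_def)
  moreover have "card (A <#> M) \<le> card M" using card_elem_ab_le[OF *(1)] maximalD(3)[OF M] by simp
  ultimately have "M = A <#> M" using *(3) by (intro card_seteq)
  then show ?thesis using *(2) by blast
qed

lemma Omega_center_subset_maximal: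
  assumes M: "maximal M" "M \<subseteq> Q" and Q: "sylow_subgroup G p Q"
  shows "Omega_center G p Q \<subseteq> M"
  by (rule maximal_absorbs[OF M(1) sylowD(4)[OF Q]]) (use M Omega_center_commute in blast)

text \<open>\<open>W\<close> has index \<open>p\<close> in \<open>M\<close>, which leaves no room in
  between. This is how the rank gap of one enters the conjugacy arguments.\<close>

lemma subgroup_between_cases:
  assumes M: "maximal M" and A: "subgroup A G" "W \<subseteq> A" "A \<subseteq> M" and W: "card W = p ^ r"
  shows "A = W \<or> A = M"
proof -
  obtain k where k: "card A = p ^ k"
    using card_subgroup_prime_power[OF prime_p A(1) maximalD(2)[OF M] A(3) maximalD(3)[OF M]] by blast
  have fin: "finite A" "finite M" using finite_subgroup A(1) maximalD(2)[OF M] by auto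
  have "p ^ r \<le> p ^ k" "p ^ k \<le> p ^ Suc r"
    using card_mono[OF fin(1) A(2)] card_mono[OF fin(2) A(3)] k W maximalD(3)[OF M] by auto
  then have "r \<le> k" "k \<le> Suc r" using p_gt_1 power_increasing_iff by blast+
  then have "k = r \<or> k = Suc r" by auto
  then show ?thesis
    using card_subset_eq[OF fin(1) A(2)] card_subset_eq[OF fin(2) A(3)] k W maximalD(3)[OF M] by auto
qed

lemma maximal_not_central_type:
  assumes "maximal M"
  shows "\<not> central_type M"
proof
  assume "central_type M"
  then obtain Q where Q: "sylow_subgroup G p Q" "M \<subseteq> Omega_center G p Q" by (auto simp: central_type_def)
  have "card M \<le> p ^ r"
    using card_mono[OF finite_subgroup Q(2)] sylowD(4)[OF Q(1)] card_Omega_center[OF Q(1)] by (auto simp: elem_ab_def)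
  then show False using maximalD(3)[OF assms] p_gt_1 power_increasing_iff[of p "Suc r" r] by simp
qed

text \<open>Take a Sylow subgroup \<open>Q\<close> containing \<open>E\<close>. The product of
  \<open>E\<close> and \<open>\<Omega>\<^sub>Q\<close> is elementary abelian and strictly larger
  than \<open>\<Omega>\<^sub>Q\<close>, so its order must be the upper bound.\<close>

lemma maximal_above_non_central:
  assumes E: "elem_ab G p E" and nc: "\<not> central_type E"
  shows "\<exists>M. maximal M \<and> E \<subseteq> M"
proof -
  have sE: "subgroup E G" using E by (simp add: elem_ab_def)
  obtain k where k: "card E = p ^ k" using card_elem_ab[OF prime_p finite_carrier E] by blast
  obtain Q where Q: "sylow_subgroup G p Q" "E \<subseteq> Q"
    using p_subgroup_le_sylow[OF prime_p finite_carrier sE k] by blast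
  let ?W = "Omega_center G p Q"
  have comm: "x \<otimes> y = y \<otimes> x" if "x \<in> E" "y \<in> ?W" for x y
    using Omega_center_commute[of y Q x] that Q(2) by auto
  note * = elem_ab_set_mult[OF E sylowD(4)[OF Q(1)] comm]
  have "\<not> E \<subseteq> ?W" using nc Q by (auto simp: central_type_def)
  then have "?W \<subset> E <#> ?W" using *(2,3) by blast
  moreover have "finite (E <#> ?W)" using finite_subgroup *(1) by (auto simp: elem_ab_def)
  ultimately have less: "p ^ r < card (E <#> ?W)"
    using card_Omega_center[OF Q(1)] psubset_card_mono by metis
  obtain n where n: "card (E <#> ?W) = p ^ n" using card_elem_ab[OF prime_p finite_carrier *(1)] by blast
  have "r < n" using less n p_gt_1 by simp
  moreover have "p ^ n \<le> p ^ Suc r" using card_elem_ab_le[OF *(1)] n by simp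
  then have "n \<le> Suc r" using p_gt_1 power_increasing_iff by blast
  ultimately have "n = Suc r" by simp
  then have "maximal (E <#> ?W)" using *(1) n by (simp add: maximal_def)
  then show ?thesis using *(2) by blast
qed

lemma subset_centralizerI:
  "A \<subseteq> carrier G \<Longrightarrow> (\<And>x y. x \<in> A \<Longrightarrow> y \<in> E \<Longrightarrow> x \<otimes> y = y \<otimes> x) \<Longrightarrow> A \<subseteq> centralizer G E"
  unfolding centralizer_def by blast

lemma subset_centralizer_swap:
  assumes "A \<subseteq> centralizer G B" "B \<subseteq> carrier G"
  shows "B \<subseteq> centralizer G A"
proof (rule subset_centralizerI[OF assms(2)])
  fix x y assume "x \<in> B" "y \<in> A"
  then have "y \<otimes> x = x \<otimes> y" using assms(1) unfolding centralizer_def by blast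
  then show "x \<otimes> y = y \<otimes> x" by (rule sym)
qed

text \<open>Both subgroups lie in the centralizer of \<open>E\<close>, so after conjugation there
  they share a Sylow subgroup of it, and hence a Sylow subgroup \<open>Q\<close> of
  \<open>G\<close>. Both then contain \<open>\<Omega>\<^sub>Q\<close>. If they differed, they would
  meet exactly in \<open>\<Omega>\<^sub>Q\<close>, and \<open>E\<close> would be of central
  type.\<close>

lemma maximal_conjugate_over:
  assumes nc: "\<not> central_type E" and M: "maximal M" "E \<subseteq> M" and N: "maximal N" "E \<subseteq> N"
  shows "\<exists>x\<in>centralizer G E. conj_set G x M = N"
proof -
  let ?C = "centralizer G E"
  have Ec: "E \<subseteq> carrier G" using M maximalD by blast
  have C: "subgroup ?C G" using Ec by (rule subgroup_centralizer)
  have Cc: "?C \<subseteq> carrier G" by (auto simp: centralizer_def)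
  have MC: "M \<subseteq> ?C" by (rule subset_centralizerI) (use maximalD[OF M(1)] M(2) in blast)+
  have NC: "N \<subseteq> ?C" by (rule subset_centralizerI) (use maximalD[OF N(1)] N(2) in blast)+
  obtain S where S: "sylow_subgroup (G\<lparr>carrier := ?C\<rparr>) p S" "M \<subseteq> S"
    using p_subgroup_le_some_sylow_in[OF prime_p finite_carrier C maximalD(2)[OF M(1)] MC maximalD(3)[OF M(1)]] by blast
  obtain x where x: "x \<in> ?C" "conj_set G x N \<subseteq> S"
    using p_subgroup_conj_into_sylow[OF prime_p finite_carrier C S(1) maximalD(2)[OF N(1)] NC maximalD(3)[OF N(1)]] by blast
  have xc: "x \<in> carrier G" using x Cc by blast
  let ?N = "conj_set G x N"
  have N': "maximal ?N" using maximal_conj[OF xc N(1)] .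
  have EN: "E \<subseteq> ?N" using conj_set_mono[OF N(2)] conj_set_centralizer[OF x(1) order_refl Ec] by metis
  note SD = sylow_subgroup_inD[OF C S(1)]
  obtain Q where Q: "sylow_subgroup G p Q" "S \<subseteq> Q"
    using p_subgroup_le_sylow[OF prime_p finite_carrier SD(1,3)] by blast
  have "Omega_center G p Q \<subseteq> M" "Omega_center G p Q \<subseteq> ?N"
    using Omega_center_subset_maximal[OF _ _ Q(1)] M(1) N' S(2) x(2) Q(2) by blast+
  then have "M \<inter> ?N = Omega_center G p Q \<or> M \<inter> ?N = M"
    using subgroups_Inter_pair[OF maximalD(2)[OF M(1)] maximalD(2)[OF N']]
    by (intro subgroup_between_cases[OF M(1)]) (auto simp: card_Omega_center[OF Q(1)])
  moreover have "M \<inter> ?N \<noteq> Omega_center G p Q" using nc M(2) EN Q(1) by (auto simp: central_type_def)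
  ultimately have "M \<subseteq> ?N" by blast
  then have MN: "M = ?N"
    using card_subset_eq[OF finite_subgroup[OF maximalD(2)[OF N']]] maximalD(3)[OF M(1)] maximalD(3)[OF N'] by simp
  have "conj_set G (inv x) M = N" unfolding MN using conj_set_inv[OF xc] maximalD(4)[OF N(1)] .
  then show ?thesis using subgroup.m_inv_closed[OF C x(1)] by blast
qed

text \<open>\<open>E\<close> is central in \<open>Q\<close>, so \<open>Q\<close> is contained in the
  centralizer of \<open>E\<close> and is a Sylow subgroup there. Sylow conjugacy can then be applied
  without moving \<open>E\<close>.\<close>

lemma sylow_subset_centralizer:
  assumes Q: "sylow_subgroup G p Q" and E: "E \<subseteq> Omega_center G p Q"
  shows "Q \<subseteq> centralizer G E" "subgroup (centralizer G E) G"
    "sylow_subgroup (G\<lparr>carrier := centralizer G E\<rparr>) p Q"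
proof -
  show 1: "Q \<subseteq> centralizer G E"
  proof (rule subset_centralizer_swap[OF _ sylowD(3)[OF Q]])
    show "E \<subseteq> centralizer G Q"
      by (rule subset_centralizerI) (use sylowD(5)[OF Q] E Omega_center_commute in blast)+
  qed
  show 2: "subgroup (centralizer G E) G"
    using subgroup_centralizer sylowD(5)[OF Q] E by blast
  show "sylow_subgroup (G\<lparr>carrier := centralizer G E\<rparr>) p Q"
    by (rule sylow_restrict[OF prime_p finite_carrier 2 Q 1])
qed

lemma Omega_center_conjugate_over:
  assumes Q: "sylow_subgroup G p Q" "E \<subseteq> Omega_center G p Q"
    and Q': "sylow_subgroup G p Q'" "E \<subseteq> Omega_center G p Q'"
  shows "\<exists>x\<in>centralizer G E. conj_set G x (Omega_center G p Q) = Omega_center G p Q'"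
proof -
  obtain x where x: "x \<in> centralizer G E" "conj_set G x Q = Q'"
    using sylow_in_conjugate[OF prime_p finite_carrier] sylow_subset_centralizer[OF Q] sylow_subset_centralizer[OF Q'] by blast
  moreover have "x \<in> carrier G" using x(1) by (auto simp: centralizer_def)
  ultimately show ?thesis using Omega_center_conj[OF sylowD(1)[OF Q(1)], of x p] by auto
qed

text \<open>\<open>M\<close> is abelian and contains \<open>E\<close>, so it is a p-subgroup of the
  centralizer of \<open>E\<close>, where \<open>Q\<close> is a Sylow subgroup.\<close>

lemma sylow_above_maximal:
  assumes Q: "sylow_subgroup G p Q" "E \<subseteq> Omega_center G p Q" and M: "maximal M" "E \<subseteq> M"
  shows "\<exists>x\<in>centralizer G E. M \<subseteq> conj_set G x Q \<and> sylow_subgroup G p (conj_set G x Q)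
    \<and> Omega_center G p (conj_set G x Q) = conj_set G x (Omega_center G p Q)"
proof -
  have MC: "M \<subseteq> centralizer G E" by (rule subset_centralizerI) (use maximalD[OF M(1)] M(2) in blast)+
  obtain x where x: "x \<in> centralizer G E" "M \<subseteq> conj_set G x Q"
    using p_subgroup_le_sylow_in[OF prime_p finite_carrier sylow_subset_centralizer(2)[OF Q]
        maximalD(2)[OF M(1)] MC maximalD(3)[OF M(1)] sylow_subset_centralizer(3)[OF Q]] by blast
  moreover have "x \<in> carrier G" using x(1) by (auto simp: centralizer_def)
  ultimately show ?thesis using Omega_center_conj[OF sylowD(1)[OF Q(1)]] sylow_conj[OF Q(1)] by blast
qed

text \<open>Replace \<open>Q\<close> by a conjugate containing \<open>M\<close>, with the conjugator
  centralizing \<open>E\<close>. The new \<open>\<Omega>\<^sub>Q\<close> still contains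
  \<open>E\<close>, and \<open>M\<close> absorbs it.\<close>

lemma Omega_center_between:
  assumes E: "central_type E" and M: "maximal M" "E \<subseteq> M"
  shows "\<exists>Q. sylow_subgroup G p Q \<and> E \<subseteq> Omega_center G p Q \<and> Omega_center G p Q \<subseteq> M"
proof -
  obtain Q where Q: "sylow_subgroup G p Q" "E \<subseteq> Omega_center G p Q" using E by (auto simp: central_type_def)
  obtain x where x: "x \<in> centralizer G E" "M \<subseteq> conj_set G x Q" "sylow_subgroup G p (conj_set G x Q)"
    "Omega_center G p (conj_set G x Q) = conj_set G x (Omega_center G p Q)"
    using sylow_above_maximal[OF Q M] by blast
  have "E \<subseteq> conj_set G x (Omega_center G p Q)"
    using conj_set_mono[OF Q(2), of x] conj_set_centralizer[OF x(1) order_refl] M(2) maximalD(4)[OF M(1)] by simp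
  then show ?thesis using x Omega_center_subset_maximal[OF M(1) x(2,3)] by metis
qed

lemma maximal_subset_normalizer:
  assumes "maximal M"
  shows "M \<subseteq> {x \<in> carrier G. conj_set G x M = M}"
proof -
  have "M \<subseteq> centralizer G M" by (rule subset_centralizerI[OF maximalD(4,5)[OF assms]])
  then show ?thesis using conj_set_centralizer[OF _ order_refl maximalD(4)[OF assms]] maximalD(4)[OF assms] by blast
qed

text \<open>By absorption \<open>M\<close> consists of all elements of order dividing \<open>p\<close> of its centralizer. If the
  normalizer \<open>D\<close> of \<open>M\<close> in \<open>Q\<close> centralized \<open>M\<close>, then \<open>M\<close> would be characteristic in \<open>D\<close>, so \<open>D\<close> would be
  self-normalizing in \<open>Q\<close>, hence equal to \<open>Q\<close>, and \<open>M\<close> would be central in \<open>Q\<close>.\<close>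

lemma not_centralized_by_normalizer:
  assumes M: "maximal M" "M \<subseteq> Q" and Q: "sylow_subgroup G p Q"
  shows "\<not> Q \<inter> {x \<in> carrier G. conj_set G x M = M} \<subseteq> centralizer G M"
proof
  let ?D = "Q \<inter> {x \<in> carrier G. conj_set G x M = M}"
  assume D: "?D \<subseteq> centralizer G M"
  note sQ = sylowD(1)[OF Q]
  have sD: "subgroup ?D G" using subgroups_Inter_pair[OF sQ subgroup_normalizer[OF maximalD(4)[OF M(1)]]] .
  have MD: "M \<subseteq> ?D" using maximal_subset_normalizer[OF M(1)] M(2) by simp
  show False
  proof (cases "?D = Q")
    case True
    then have "Q \<subseteq> centralizer G M" using D by simp
    then have "M \<subseteq> centralizer G Q" using subset_centralizer_swap maximalD(4)[OF M(1)] by blast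
    then have "M \<subseteq> Omega_center G p Q"
      using M(2) maximalD(1)[OF M(1)]
      unfolding Omega_center_def center_of_def centralizer_def elem_ab_def by blast
    then have "central_type M" using Q by (auto simp: central_type_def)
    then show False using maximal_not_central_type[OF M(1)] by simp
  next
    case False
    interpret Q: group "G\<lparr>carrier := Q\<rparr>" using sQ is_group by (rule subgroup.subgroup_is_group)
    have "\<exists>x\<in>carrier (G\<lparr>carrier := Q\<rparr>) - ?D. conj_set (G\<lparr>carrier := Q\<rparr>) x ?D \<subseteq> ?D"
      by (rule Q.p_group_normalizer_grows[OF prime_p])
        (use sylowD(2)[OF Q] subgroup_incl[OF sD sQ] False finite_subgroup[OF sQ] in \<open>auto simp: order_def\<close>)
    then obtain x where x: "x \<in> Q" "x \<notin> ?D" "conj_set G x ?D \<subseteq> ?D"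
      using conj_set_consistent[OF sQ] by auto
    have xc: "x \<in> carrier G" using x(1) sylowD(3)[OF Q] by blast
    have "conj_set G x M \<subseteq> centralizer G M" using conj_set_mono[OF MD, of x] x(3) D by blast
    then have "conj_set G x M \<subseteq> M"
      by (intro maximal_absorbs[OF M(1) elem_ab_conj[OF xc maximalD(1)[OF M(1)]]]) (auto simp: centralizer_def)
    then have "conj_set G x M = M"
      using card_subset_eq[OF finite_subgroup[OF maximalD(2)[OF M(1)]]] card_conj_set[OF xc maximalD(4)[OF M(1)]] by blast
    then show False using x(1,2) xc by blast
  qed
qed

text \<open>A Sylow subgroup \<open>R\<close> of \<open>H\<close> determines the subgroup of \<open>M\<close> in question as its fixed points, so that
  Sylow conjugacy in \<open>H\<close> moves any two of these subgroups to each other while stabilizing \<open>M\<close>.\<close>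

lemma Omega_center_fixed_by_sylow:
  assumes Q: "sylow_subgroup G p Q" and M: "maximal M" "Omega_center G p Q \<subseteq> M"
    and E: "E \<subseteq> Omega_center G p Q"
  defines "H \<equiv> centralizer G E \<inter> {x \<in> carrier G. conj_set G x M = M}"
  shows "\<exists>R. sylow_subgroup (G\<lparr>carrier := H\<rparr>) p R \<and> Omega_center G p Q = M \<inter> centralizer G R"
proof -
  let ?W = "Omega_center G p Q" and ?N = "{x \<in> carrier G. conj_set G x M = M}"
  have Wc: "?W \<subseteq> carrier G" using sylowD(5)[OF Q] .
  have cW: "card ?W = p ^ r" using card_Omega_center[OF Q] .
  \<comment> \<open>The given \<open>Q\<close> need not contain \<open>M\<close>. A conjugate of it
    under the centralizer of \<open>\<Omega>\<^sub>Q\<close> does, with the same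
    \<open>\<Omega>\<^sub>Q\<close>.\<close>
  obtain x where x: "x \<in> centralizer G ?W" "M \<subseteq> conj_set G x Q" "sylow_subgroup G p (conj_set G x Q)"
    "Omega_center G p (conj_set G x Q) = conj_set G x ?W"
    using sylow_above_maximal[OF Q order_refl M] by blast
  define Q1 where "Q1 = conj_set G x Q"
  have Q1: "M \<subseteq> Q1" "sylow_subgroup G p Q1" "Omega_center G p Q1 = ?W"
    using x conj_set_centralizer[OF x(1) order_refl Wc] by (auto simp: Q1_def)
  define D where "D = Q1 \<inter> ?N"
  have sN: "subgroup ?N G" using subgroup_normalizer[OF maximalD(4)[OF M(1)]] .
  have sD: "subgroup D G" unfolding D_def using subgroups_Inter_pair[OF sylowD(1)[OF Q1(2)] sN] .
  have DM: "\<not> D \<subseteq> centralizer G M" unfolding D_def by (rule not_centralized_by_normalizer[OF M(1) Q1(1,2)])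
  have DW: "D \<subseteq> centralizer G ?W"
    using sylow_subset_centralizer(1)[OF Q1(2), of ?W] Q1(3) by (auto simp: D_def)
  have sH: "subgroup H G"
    unfolding H_def using subgroups_Inter_pair[OF subgroup_centralizer sN] E Wc by blast
  have "centralizer G ?W \<subseteq> centralizer G E" using E by (auto simp: centralizer_def)
  then have DH: "D \<subseteq> H" using DW by (auto simp: H_def D_def)
  obtain k where k: "card D = p ^ k"
    using card_subgroup_prime_power[OF prime_p sD sylowD(1)[OF Q1(2)] _ sylowD(2)[OF Q1(2)]] by (auto simp: D_def)
  obtain R where R: "sylow_subgroup (G\<lparr>carrier := H\<rparr>) p R" "D \<subseteq> R"
    using p_subgroup_le_some_sylow_in[OF prime_p finite_carrier sH sD DH k] by blast
  note RD = sylow_subgroup_inD[OF sH R(1)]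
  \<comment> \<open>Since \<open>M \<subseteq> D \<subseteq> R \<subseteq> Q2\<close>, the subgroup
    \<open>Omega_center G p Q2\<close> lies in \<open>M\<close> and is centralized by
    \<open>R\<close>. It is therefore squeezed into \<open>?W\<close>, and equality of orders closes
    the argument.\<close>
  obtain Q2 where Q2: "sylow_subgroup G p Q2" "R \<subseteq> Q2"
    using p_subgroup_le_sylow[OF prime_p finite_carrier RD(1,3)] by blast
  have "M \<subseteq> D" using maximal_subset_normalizer[OF M(1)] Q1(1) by (simp add: D_def)
  then have W2M: "Omega_center G p Q2 \<subseteq> M"
    using Omega_center_subset_maximal[OF M(1) _ Q2(1)] R(2) Q2(2) by blast
  have Dc: "D \<subseteq> carrier G" using subgroup.subset[OF sD] .
  \<comment> \<open>The fixed points of \<open>D\<close> in \<open>M\<close> contain the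
    index-\<open>p\<close> subgroup \<open>?W\<close>. They are not all of \<open>M\<close>, because
    \<open>D\<close> does not centralize \<open>M\<close>.\<close>
  have "M \<inter> centralizer G D = ?W \<or> M \<inter> centralizer G D = M"
  proof (rule subgroup_between_cases[OF M(1)])
    show "subgroup (M \<inter> centralizer G D) G"
      using subgroups_Inter_pair[OF maximalD(2)[OF M(1)] subgroup_centralizer[OF Dc]] .
    have "?W \<subseteq> centralizer G D"
      by (rule subset_centralizer_swap[OF DW Wc])
    then show "?W \<subseteq> M \<inter> centralizer G D" using M(2) by blast
  qed (use cW in auto)
  moreover have "M \<inter> centralizer G D \<noteq> M"
  proof
    assume "M \<inter> centralizer G D = M"
    then have "M \<subseteq> centralizer G D" by blast
    then have "D \<subseteq> centralizer G M"
      by (rule subset_centralizer_swap[OF _ Dc])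
    then show False using DM by simp
  qed
  ultimately have "M \<inter> centralizer G D = ?W" by simp
  moreover have "centralizer G R \<subseteq> centralizer G D" using R(2) by (auto simp: centralizer_def)
  ultimately have RW: "M \<inter> centralizer G R \<subseteq> ?W" by blast
  have "Omega_center G p Q2 \<subseteq> centralizer G R"
    by (rule subset_centralizerI[OF sylowD(5)[OF Q2(1)]]) (use Omega_center_commute Q2(2) in blast)
  with W2M have 2: "Omega_center G p Q2 \<subseteq> M \<inter> centralizer G R" by blast
  have "finite ?W" using finite_subgroup sylowD(4)[OF Q] by (auto simp: elem_ab_def)
  then have "Omega_center G p Q2 = ?W"
    using card_subset_eq[OF _ order_trans[OF 2 RW]] cW card_Omega_center[OF Q2(1)] by simp
  then show ?thesis using 2 RW R(1) by blast
qed

lemma Omega_center_conjugate_within: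
  assumes Q: "sylow_subgroup G p Q" "E \<subseteq> Omega_center G p Q" "Omega_center G p Q \<subseteq> M"
    and Q': "sylow_subgroup G p Q'" "E \<subseteq> Omega_center G p Q'" "Omega_center G p Q' \<subseteq> M"
    and M: "maximal M"
  shows "\<exists>x\<in>centralizer G E. conj_set G x M = M \<and> conj_set G x (Omega_center G p Q) = Omega_center G p Q'"
proof -
  let ?H = "centralizer G E \<inter> {x \<in> carrier G. conj_set G x M = M}"
  have sH: "subgroup ?H G"
    by (rule subgroups_Inter_pair[OF subgroup_centralizer subgroup_normalizer[OF maximalD(4)[OF M]]])
      (use Q(2) sylowD(5)[OF Q(1)] in blast)
  obtain R where R: "sylow_subgroup (G\<lparr>carrier := ?H\<rparr>) p R" "Omega_center G p Q = M \<inter> centralizer G R"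
    using Omega_center_fixed_by_sylow[OF Q(1) M Q(3,2)] by blast
  obtain R' where R': "sylow_subgroup (G\<lparr>carrier := ?H\<rparr>) p R'" "Omega_center G p Q' = M \<inter> centralizer G R'"
    using Omega_center_fixed_by_sylow[OF Q'(1) M Q'(3,2)] by blast
  obtain x where x: "x \<in> ?H" "conj_set G x R = R'"
    using sylow_in_conjugate[OF prime_p finite_carrier sH R(1) R'(1)] by blast
  have xc: "x \<in> carrier G" and xM: "conj_set G x M = M" using x(1) by auto
  have Rc: "R \<subseteq> carrier G" using subgroup.subset[OF sylow_subgroup_inD(1)[OF sH R(1)]] .
  \<comment> \<open>Conjugation by \<open>x\<close> stabilizes \<open>M\<close> and carries fixed
    points of \<open>R\<close> to fixed points of \<open>R'\<close>. One inclusion suffices because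
    the orders agree.\<close>
  have "conj_set G x (M \<inter> centralizer G R) \<subseteq> centralizer G R'"
  proof (rule subset_centralizerI)
    show "conj_set G x (M \<inter> centralizer G R) \<subseteq> carrier G"
      using conj_set_closed[OF xc] maximalD(4)[OF M] by blast
    fix a b assume "a \<in> conj_set G x (M \<inter> centralizer G R)" "b \<in> R'"
    then obtain u v where u: "u \<in> centralizer G R" "a = x \<otimes> u \<otimes> inv x" and v: "v \<in> R" "b = x \<otimes> v \<otimes> inv x"
      unfolding x(2)[symmetric] conj_set_def by auto
    have uv: "u \<otimes> v = v \<otimes> u" "u \<in> carrier G" "v \<in> carrier G"
      using u(1) v(1) Rc unfolding centralizer_def by blast+
    show "a \<otimes> b = b \<otimes> a" unfolding u(2) v(2) conj_mult[OF xc uv(2,3)] conj_mult[OF xc uv(3,2)] uv(1) ..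
  qed
  moreover have "conj_set G x (M \<inter> centralizer G R) \<subseteq> M"
    using conj_set_mono[of "M \<inter> centralizer G R" M x] xM by blast
  ultimately have "conj_set G x (Omega_center G p Q) \<subseteq> Omega_center G p Q'" 
    unfolding R(2) R'(2) by simp
  moreover have "finite (Omega_center G p Q')" using finite_subgroup sylowD(4)[OF Q'(1)] by (auto simp: elem_ab_def)
  ultimately have "conj_set G x (Omega_center G p Q) = Omega_center G p Q'"
    using card_subset_eq card_conj_set[OF xc sylowD(5)[OF Q(1)]] card_Omega_center[OF Q(1)] card_Omega_center[OF Q'(1)] by metis
  then show ?thesis using x(1) xM by blast
qed

end

subsection \<open>Maps of the orbit space\<close>

lemma openin_orbit_space:
  "openin (orbit_space G p) U \<longleftrightarrow> U \<subseteq> chain_orbits G p \<and>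
     (\<forall>x\<in>U. \<forall>y\<in>chain_orbits G p. orbit_le y x \<longrightarrow> y \<in> U)"
proof -
  have "istopology (\<lambda>U. U \<subseteq> chain_orbits G p \<and>
     (\<forall>x\<in>U. \<forall>y\<in>chain_orbits G p. orbit_le y x \<longrightarrow> y \<in> U))"
    unfolding istopology_def by blast
  then show ?thesis unfolding orbit_space_def by (simp add: topology_inverse')
qed

lemma topspace_orbit_space: "topspace (orbit_space G p) = chain_orbits G p"
proof
  show "topspace (orbit_space G p) \<subseteq> chain_orbits G p"
    using openin_topspace[of "orbit_space G p"] unfolding openin_orbit_space by simp
  have "openin (orbit_space G p) (chain_orbits G p)" unfolding openin_orbit_space by simp
  then show "chain_orbits G p \<subseteq> topspace (orbit_space G p)" by (rule openin_subset)
qed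

text \<open>If \<open>f\<close> lies below \<open>g\<close> in the specialization order, jumping from \<open>f\<close> to \<open>g\<close> at time 1 is continuous.\<close>

lemma homotopic_with_specialization:
  assumes f: "continuous_map X Y f" and g: "continuous_map X Y g"
    and le: "\<And>U x. openin Y U \<Longrightarrow> x \<in> topspace X \<Longrightarrow> g x \<in> U \<Longrightarrow> f x \<in> U"
  shows "homotopic_with (\<lambda>_. True) X Y f g"
proof -
  let ?I = "top_of_set {0..1::real}"
  let ?h = "\<lambda>(t, x). if t < 1 then f x else g x"
  have "continuous_map (prod_topology ?I X) Y ?h"
    unfolding continuous_map_def
  proof (intro conjI allI impI)
    show "?h \<in> topspace (prod_topology ?I X) \<rightarrow> topspace Y"
      using f g by (auto simp: continuous_map_def)
    fix U assume U: "openin Y U"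
    let ?F = "{x \<in> topspace X. f x \<in> U}" and ?G = "{x \<in> topspace X. g x \<in> U}"
    \<comment> \<open>The slice at time 1 is the preimage under \<open>g\<close>. By
      \<open>le\<close> it lies in the preimage under \<open>f\<close>, so it may be thickened to
      all times without changing the union, which is then open.\<close>
    have "{z \<in> topspace (prod_topology ?I X). ?h z \<in> U} = {0..<1} \<times> ?F \<union> {0..1} \<times> ?G"
      using le[OF U] by (auto split: if_splits)
    moreover have "openin X ?F" "openin X ?G" using f g U by (auto simp: continuous_map_def)
    moreover have "{0..<1} = {0..1} \<inter> {..<1::real}" by auto
    then have "openin ?I {0..<1}" using open_lessThan[of "1::real"] unfolding openin_open by metis
    moreover have "openin ?I {0..1}" using openin_topspace[of ?I] by (simp only: topspace_euclidean_subtopology)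
    ultimately show "openin (prod_topology ?I X) {z \<in> topspace (prod_topology ?I X). ?h z \<in> U}"
      by (simp only: openin_Un openin_prod_Times_iff simp_thms)
  qed
  then show ?thesis
    unfolding homotopic_with_def by (intro exI[of _ ?h]) auto
qed

context group
begin

section \<open>Chains up to conjugation\<close>

definition chain_orbit :: "'a set set \<Rightarrow> 'a set set set" where
  "chain_orbit c = {conj_chain G g c | g. g \<in> carrier G}"

lemma conj_chain_eq: "conj_chain G g c = conj_set G g ` c"
  by (simp add: conj_chain_def conj_set_def)

lemma chain_orbits_eq: "chain_orbits G p = chain_orbit ` Ap_chains G p"
  by (auto simp: chain_orbits_def chain_orbit_def)

lemma Ap_chainsD:
  assumes "c \<in> Ap_chains G p"
  shows "c \<noteq> {}" "c \<subseteq> Ap G p" "c \<subseteq> Pow (carrier G)" "\<And>E F. E \<in> c \<Longrightarrow> F \<in> c \<Longrightarrow> E \<subseteq> F \<or> F \<subseteq> E"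
proof -
  show c: "c \<noteq> {}" "c \<subseteq> Ap G p" using assms by (auto simp: Ap_chains_def)
  show "c \<subseteq> Pow (carrier G)" using c(2) elem_ab_carrier by (auto simp: Ap_def)
  show "E \<subseteq> F \<or> F \<subseteq> E" if "E \<in> c" "F \<in> c" for E F using assms that unfolding Ap_chains_def by blast
qed

lemma conj_chain_one: "c \<subseteq> Pow (carrier G) \<Longrightarrow> conj_chain G \<one> c = c"
  unfolding conj_chain_eq by (force simp: conj_set_one subset_iff image_iff)

lemma conj_chain_mult:
  "g \<in> carrier G \<Longrightarrow> h \<in> carrier G \<Longrightarrow> c \<subseteq> Pow (carrier G)
    \<Longrightarrow> conj_chain G (g \<otimes> h) c = conj_chain G g (conj_chain G h c)"
  unfolding conj_chain_eq image_image by (intro image_cong) (auto simp: conj_set_mult)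

lemma conj_chain_insert: "conj_chain G g (insert A c) = insert (conj_set G g A) (conj_chain G g c)"
  by (simp add: conj_chain_eq)

lemma Union_conj_chain: "\<Union> (conj_chain G g c) = conj_set G g (\<Union> c)"
  by (simp add: conj_chain_eq conj_set_def image_Union)

lemma conj_chain_centralizer:
  assumes "x \<in> centralizer G E" "\<Union> c \<subseteq> E" "c \<subseteq> Pow (carrier G)"
  shows "conj_chain G x c = c"
proof -
  have "conj_set G x A = A" if "A \<in> c" for A
    by (rule conj_set_centralizer[OF assms(1)]) (use assms that in auto)
  then show ?thesis by (simp add: conj_chain_eq)
qed

lemma Ap_conj:
  assumes g: "g \<in> carrier G" and E: "E \<in> Ap G p"
  shows "conj_set G g E \<in> Ap G p"
proof -
  have *: "elem_ab G p E" "E \<noteq> {\<one>}" using E by (auto simp: Ap_def)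
  have "conj_set G g E \<noteq> {\<one>}"
  proof
    assume "conj_set G g E = {\<one>}"
    then have "E = conj_set G (inv g) {\<one>}" using conj_set_inv[OF g elem_ab_carrier[OF *(1)]] by simp
    then show False using * g by (simp add: conj_set_def)
  qed
  then show ?thesis using elem_ab_conj[OF g *(1)] by (simp add: Ap_def)
qed

lemma Ap_chains_conj:
  assumes g: "g \<in> carrier G" and c: "c \<in> Ap_chains G p"
  shows "conj_chain G g c \<in> Ap_chains G p"
  unfolding Ap_chains_def
proof (intro CollectI conjI ballI)
  note * = Ap_chainsD[OF c]
  show "conj_chain G g c \<noteq> {}" using *(1) by (simp add: conj_chain_eq)
  show "conj_chain G g c \<subseteq> Ap G p" using *(2) Ap_conj[OF g] by (auto simp: conj_chain_eq)
  fix E F assume "E \<in> conj_chain G g c" "F \<in> conj_chain G g c"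
  then obtain A B where "A \<in> c" "B \<in> c" "E = conj_set G g A" "F = conj_set G g B" by (auto simp: conj_chain_eq)
  then show "E \<subseteq> F \<or> F \<subseteq> E" using *(4)[of A B] conj_set_mono[of A B g] conj_set_mono[of B A g] by auto
qed

lemma chain_orbit_conj:
  assumes g: "g \<in> carrier G" and c: "c \<subseteq> Pow (carrier G)"
  shows "chain_orbit (conj_chain G g c) = chain_orbit c"
proof
  show "chain_orbit (conj_chain G g c) \<subseteq> chain_orbit c"
    using g c by (auto simp: chain_orbit_def conj_chain_mult[symmetric])
  show "chain_orbit c \<subseteq> chain_orbit (conj_chain G g c)"
  proof
    fix d assume "d \<in> chain_orbit c"
    then obtain h where h: "h \<in> carrier G" "d = conj_chain G h c" by (auto simp: chain_orbit_def)
    have "d = conj_chain G (h \<otimes> inv g) (conj_chain G g c)"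
      using g h c by (simp add: conj_chain_mult[symmetric] m_assoc)
    then show "d \<in> chain_orbit (conj_chain G g c)" using g h unfolding chain_orbit_def by blast
  qed
qed

lemma chain_orbit_memD:
  assumes "u \<in> chain_orbits G p" "c \<in> u"
  shows "c \<in> Ap_chains G p" "u = chain_orbit c"
proof -
  obtain d where d: "d \<in> Ap_chains G p" "u = chain_orbit d" using assms(1) by (auto simp: chain_orbits_eq)
  then obtain g where g: "g \<in> carrier G" "c = conj_chain G g d" using assms(2) by (auto simp: chain_orbit_def)
  show "c \<in> Ap_chains G p" using Ap_chains_conj[OF g(1) d(1)] g(2) by simp
  show "u = chain_orbit c" using chain_orbit_conj[OF g(1) Ap_chainsD(3)[OF d(1)]] d g by simp
qed

lemma orbit_leI:
  assumes "x \<in> carrier G" "conj_chain G x c \<subseteq> d" "d \<subseteq> Pow (carrier G)"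
  shows "orbit_le (chain_orbit c) (chain_orbit d)"
proof -
  have "d \<in> chain_orbit d" using conj_chain_one[OF assms(3)] unfolding chain_orbit_def by force
  then show ?thesis using assms(1,2) unfolding orbit_le_def chain_orbit_def by blast
qed

text \<open>\<open>R\<close> may relate a chain to several images; only some choice has to represent
  the value of \<open>f\<close>. Independence of the choice enters through the comparison hypotheses
  of \<open>induces_continuous\<close> and \<open>induces_homotopic\<close>, which range over all
  choices.\<close>

definition induces :: "nat \<Rightarrow> ('a set set \<Rightarrow> 'a set set \<Rightarrow> bool) \<Rightarrow> ('a set set set \<Rightarrow> 'a set set set) \<Rightarrow> bool" where
  "induces p R f \<longleftrightarrow> (\<forall>c\<in>Ap_chains G p. \<exists>c'\<in>Ap_chains G p. R c c' \<and> f (chain_orbit c) = chain_orbit c')"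

text \<open>The order of orbits read off on representatives.\<close>

definition subconj :: "'a set set \<Rightarrow> 'a set set \<Rightarrow> bool" where
  "subconj c d \<longleftrightarrow> (\<exists>x\<in>carrier G. conj_chain G x c \<subseteq> d)"

lemma subset_imp_subconj: "c \<subseteq> d \<Longrightarrow> c \<subseteq> Pow (carrier G) \<Longrightarrow> subconj c d"
  unfolding subconj_def using conj_chain_one by blast

text \<open>Choose an image for one representative of each orbit; equivariance transports this
  choice to the other representatives without changing its orbit.\<close>

lemma induces_exists:
  assumes total: "\<And>c. c \<in> Ap_chains G p \<Longrightarrow> \<exists>c'\<in>Ap_chains G p. R c c'"
    and equivariant: "\<And>g c c'. g \<in> carrier G \<Longrightarrow> c \<in> Ap_chains G p \<Longrightarrow> c' \<in> Ap_chains G p \<Longrightarrow> R c c'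
      \<Longrightarrow> R (conj_chain G g c) (conj_chain G g c')"
  shows "\<exists>f. induces p R f"
proof -
  have "\<exists>v. \<forall>c\<in>u. \<exists>c'\<in>Ap_chains G p. R c c' \<and> v = chain_orbit c'" if u: "u \<in> chain_orbits G p" for u
  proof -
    obtain d where d: "d \<in> Ap_chains G p" "u = chain_orbit d" using u by (auto simp: chain_orbits_eq)
    obtain d' where d': "d' \<in> Ap_chains G p" "R d d'" using total[OF d(1)] by blast
    have "\<exists>c'\<in>Ap_chains G p. R c c' \<and> chain_orbit d' = chain_orbit c'" if "c \<in> u" for c
    proof -
      obtain g where g: "g \<in> carrier G" "c = conj_chain G g d" using \<open>c \<in> u\<close> d by (auto simp: chain_orbit_def)
      show ?thesis
        using equivariant[OF g(1) d(1) d'] Ap_chains_conj[OF g(1) d'(1)] chain_orbit_conj[OF g(1) Ap_chainsD(3)[OF d'(1)]] g(2)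
        by metis
    qed
    then show ?thesis by blast
  qed
  then obtain f where f: "\<And>u c. u \<in> chain_orbits G p \<Longrightarrow> c \<in> u \<Longrightarrow> \<exists>c'\<in>Ap_chains G p. R c c' \<and> f u = chain_orbit c'"
    by metis
  have "c \<in> chain_orbit c" if "c \<in> Ap_chains G p" for c
    using conj_chain_one[OF Ap_chainsD(3)[OF that]] unfolding chain_orbit_def by force
  then have "induces p R f" unfolding induces_def using f by (auto simp: chain_orbits_eq)
  then show ?thesis by blast
qed

lemma induces_closed:
  "induces p R f \<Longrightarrow> u \<in> chain_orbits G p \<Longrightarrow> f u \<in> chain_orbits G p"
  unfolding chain_orbits_eq induces_def by fastforce

text \<open>Continuity for the topology of down-sets is monotonicity, and comparable orbits have
  nested representatives, so nested chains are all that has to be compared.\<close>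

lemma induces_continuous:
  assumes f: "induces p R f"
    and mono: "\<And>c d c' d'. c \<in> Ap_chains G p \<Longrightarrow> d \<in> Ap_chains G p \<Longrightarrow> c \<subseteq> d \<Longrightarrow> R c c' \<Longrightarrow> R d d' \<Longrightarrow> subconj c' d'"
  shows "continuous_map (orbit_space G p) (orbit_space G p) f"
proof -
  have le: "orbit_le (f u) (f v)"
    if u: "u \<in> chain_orbits G p" and v: "v \<in> chain_orbits G p" "orbit_le u v" for u v
  proof -
    obtain c d where cd: "c \<in> u" "d \<in> v" "c \<subseteq> d" using v(2) by (auto simp: orbit_le_def)
    note c = chain_orbit_memD[OF u cd(1)] and d = chain_orbit_memD[OF v(1) cd(2)]
    obtain c' where c': "c' \<in> Ap_chains G p" "R c c'" "f u = chain_orbit c'" using f c by (auto simp: induces_def)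
    obtain d' where d': "d' \<in> Ap_chains G p" "R d d'" "f v = chain_orbit d'" using f d by (auto simp: induces_def)
    obtain x where x: "x \<in> carrier G" "conj_chain G x c' \<subseteq> d'"
      using mono[OF c(1) d(1) cd(3) c'(2) d'(2)] by (auto simp: subconj_def)
    show ?thesis unfolding c'(3) d'(3) by (rule orbit_leI[OF x Ap_chainsD(3)[OF d'(1)]])
  qed
  show ?thesis
    unfolding continuous_map_def topspace_orbit_space openin_orbit_space
    using le induces_closed[OF f] by blast
qed

text \<open>The value of \<open>f\<close> lies below that of \<open>g\<close> at every orbit, so
  each open set, being a down-set, that contains the latter contains the former.\<close>

lemma induces_homotopic:
  assumes f: "induces p R f" and g: "induces p S g"
    and cont: "continuous_map (orbit_space G p) (orbit_space G p) f" "continuous_map (orbit_space G p) (orbit_space G p) g"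
    and le: "\<And>c c' c''. c \<in> Ap_chains G p \<Longrightarrow> R c c' \<Longrightarrow> S c c'' \<Longrightarrow> subconj c' c''"
  shows "homotopic_with (\<lambda>_. True) (orbit_space G p) (orbit_space G p) f g"
proof (rule homotopic_with_specialization[OF cont])
  fix U u assume U: "openin (orbit_space G p) U" and u: "u \<in> topspace (orbit_space G p)" "g u \<in> U"
  obtain c where c: "c \<in> Ap_chains G p" "u = chain_orbit c"
    using u(1) by (auto simp: topspace_orbit_space chain_orbits_eq)
  obtain c' where c': "c' \<in> Ap_chains G p" "R c c'" "f u = chain_orbit c'" using f c by (auto simp: induces_def)
  obtain d' where d': "d' \<in> Ap_chains G p" "S c d'" "g u = chain_orbit d'" using g c by (auto simp: induces_def)
  obtain x where x: "x \<in> carrier G" "conj_chain G x c' \<subseteq> d'"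
    using le[OF c(1) c'(2) d'(2)] by (auto simp: subconj_def)
  have "orbit_le (f u) (g u)" unfolding c'(3) d'(3) by (rule orbit_leI[OF x Ap_chainsD(3)[OF d'(1)]])
  moreover have "f u \<in> chain_orbits G p" using c' by (auto simp: chain_orbits_eq)
  ultimately show "f u \<in> U" using U u(2) unfolding openin_orbit_space by blast
qed

end

subsection \<open>The homotopy to a constant\<close>

text \<open>The union of a finite chain is its top member. As central type passes to subsets,
  \<open>central_type (\<Union> c)\<close> then says that all members of \<open>c\<close> are of
  central type.\<close>

lemma Union_finite_chain_mem:
  assumes "finite c" "c \<noteq> {}" "\<And>E F. E \<in> c \<Longrightarrow> F \<in> c \<Longrightarrow> E \<subseteq> F \<or> F \<subseteq> E"
  shows "\<Union> c \<in> c"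
  using assms
proof (induction rule: finite_ne_induct)
  case (insert A c)
  then have "\<Union> c \<in> c" by blast
  with insert.prems[of A "\<Union> c"] show ?case by (auto simp: Un_absorb1 Un_absorb2)
qed simp

context p_rank_gap
begin

definition central_part :: "'a set set \<Rightarrow> 'a set set" where
  "central_part c = {E \<in> c. central_type E}"

text \<open>The four relations below are choices of an image chain; they become maps only after passing to
  orbits, where all choices agree.\<close>

definition add_maximal :: "'a set set \<Rightarrow> 'a set set \<Rightarrow> bool" where
  "add_maximal c c' \<longleftrightarrow> (if central_type (\<Union> c) then c' = c
     else \<exists>M. maximal M \<and> \<Union> c \<subseteq> M \<and> c' = insert M c)"

definition drop_non_central :: "'a set set \<Rightarrow> 'a set set \<Rightarrow> bool" where
  "drop_non_central c c' \<longleftrightarrow> (if central_type (\<Union> c) then c' = c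
     else \<exists>M. maximal M \<and> \<Union> c \<subseteq> M \<and> c' = insert M (central_part c))"

definition add_Omega_center :: "'a set set \<Rightarrow> 'a set set \<Rightarrow> bool" where
  "add_Omega_center c c' \<longleftrightarrow> (if central_type (\<Union> c)
     then \<exists>Q. sylow_subgroup G p Q \<and> \<Union> c \<subseteq> Omega_center G p Q \<and> c' = insert (Omega_center G p Q) c
     else \<exists>M Q. maximal M \<and> \<Union> c \<subseteq> M \<and> sylow_subgroup G p Q
       \<and> \<Union> (central_part c) \<subseteq> Omega_center G p Q \<and> Omega_center G p Q \<subseteq> M
       \<and> c' = insert M (insert (Omega_center G p Q) (central_part c)))"

definition only_Omega_center :: "'a set set \<Rightarrow> 'a set set \<Rightarrow> bool" where
  "only_Omega_center c c' \<longleftrightarrow> (\<exists>Q. sylow_subgroup G p Q \<and> c' = {Omega_center G p Q})"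

lemma central_type_subset: "E \<subseteq> F \<Longrightarrow> central_type F \<Longrightarrow> central_type E"
  unfolding central_type_def by blast

text \<open>Covers chains without central members, whose central part has empty union.\<close>

lemma central_type_empty: "central_type {}"
  using sylow_subgroup_exists[OF prime_p finite_carrier] by (auto simp: central_type_def)

lemma central_type_conj_iff:
  assumes "g \<in> carrier G" "E \<subseteq> carrier G"
  shows "central_type (conj_set G g E) \<longleftrightarrow> central_type E"
  using central_type_conj[OF assms(1), of E] central_type_conj[of "inv g" "conj_set G g E"] conj_set_inv[OF assms] assms(1)
  by auto

lemma central_part_subset: "central_part c \<subseteq> c"
  by (auto simp: central_part_def)

lemma central_part_mono: "c \<subseteq> d \<Longrightarrow> central_part c \<subseteq> central_part d"
  by (auto simp: central_part_def)

lemma central_part_eq: "central_type (\<Union> c) \<Longrightarrow> central_part c = c"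
  using central_type_subset unfolding central_part_def by blast

lemma central_part_conj:
  assumes "g \<in> carrier G" "c \<subseteq> Pow (carrier G)"
  shows "central_part (conj_chain G g c) = conj_chain G g (central_part c)"
proof -
  have "central_type (conj_set G g E) \<longleftrightarrow> central_type E" if "E \<in> c" for E
    using central_type_conj_iff[OF assms(1)] assms(2) that by blast
  then show ?thesis unfolding central_part_def conj_chain_eq by auto
qed

lemma finite_chain: "c \<subseteq> Pow (carrier G) \<Longrightarrow> finite c"
  using finite_carrier by (meson finite_Pow_iff finite_subset)

lemma Union_chain_elem_ab:
  assumes "c \<in> Ap_chains G p"
  shows "elem_ab G p (\<Union> c)"
proof -
  note * = Ap_chainsD[OF assms]
  have "\<Union> c \<in> c" by (rule Union_finite_chain_mem[OF finite_chain[OF *(3)] *(1)]) (rule *(4))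
  then show ?thesis using *(2) by (auto simp: Ap_def)
qed

lemma central_type_Union_central_part:
  assumes "c \<in> Ap_chains G p"
  shows "central_type (\<Union> (central_part c))"
proof (cases "central_part c = {}")
  case False
  note * = Ap_chainsD[OF assms]
  have "finite (central_part c)" using finite_subset[OF central_part_subset finite_chain[OF *(3)]] .
  then have "\<Union> (central_part c) \<in> central_part c"
    by (rule Union_finite_chain_mem[OF _ False]) (use *(4) central_part_subset in blast)
  then show ?thesis by (simp add: central_part_def)
qed (simp add: central_type_empty)

lemma maximal_Ap: "maximal M \<Longrightarrow> M \<in> Ap G p"
  using maximalD(1,3)[of M] p_gt_1 power_eq_1_iff[of p "Suc r"] by (auto simp: Ap_def)

lemma Omega_center_Ap: "sylow_subgroup G p Q \<Longrightarrow> Omega_center G p Q \<in> Ap G p"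
  using sylowD(4)[of Q] card_Omega_center[of Q] one_less_power[OF p_gt_1 r_pos]
  by (auto simp: Ap_def)

text \<open>The chain condition is spelled out instead of assuming membership in
  \<open>Ap_chains\<close>, so that \<open>c\<close> may be empty; a central part can be.\<close>

lemma insert_top_Ap_chains:
  assumes "c \<subseteq> Ap G p" "\<And>E F. E \<in> c \<Longrightarrow> F \<in> c \<Longrightarrow> E \<subseteq> F \<or> F \<subseteq> E" "A \<in> Ap G p" "\<Union> c \<subseteq> A"
  shows "insert A c \<in> Ap_chains G p"
  unfolding Ap_chains_def
proof (intro CollectI conjI ballI)
  fix E F assume "E \<in> insert A c" "F \<in> insert A c"
  then show "E \<subseteq> F \<or> F \<subseteq> E" using assms(2)[of E F] assms(4) by auto
qed (use assms(1,3) in auto)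

lemma central_partD:
  assumes "c \<in> Ap_chains G p"
  shows "central_part c \<subseteq> Ap G p" "\<And>E F. E \<in> central_part c \<Longrightarrow> F \<in> central_part c \<Longrightarrow> E \<subseteq> F \<or> F \<subseteq> E"
  using Ap_chainsD(2,4)[OF assms] by (auto simp: central_part_def)

section \<open>Existence of image chains\<close>

lemma add_maximal_total:
  assumes c: "c \<in> Ap_chains G p"
  shows "\<exists>c'\<in>Ap_chains G p. add_maximal c c'"
proof (cases "central_type (\<Union> c)")
  case False
  obtain M where M: "maximal M" "\<Union> c \<subseteq> M" using maximal_above_non_central[OF Union_chain_elem_ab[OF c] False] by metis
  have "insert M c \<in> Ap_chains G p"
    by (rule insert_top_Ap_chains[OF Ap_chainsD(2,4)[OF c] maximal_Ap[OF M(1)] M(2)])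
  then show ?thesis using False M by (auto simp: add_maximal_def)
qed (use c in \<open>auto simp: add_maximal_def\<close>)

lemma drop_non_central_total:
  assumes c: "c \<in> Ap_chains G p"
  shows "\<exists>c'\<in>Ap_chains G p. drop_non_central c c'"
proof (cases "central_type (\<Union> c)")
  case False
  obtain M where M: "maximal M" "\<Union> c \<subseteq> M" using maximal_above_non_central[OF Union_chain_elem_ab[OF c] False] by metis
  have "insert M (central_part c) \<in> Ap_chains G p"
    by (rule insert_top_Ap_chains[OF central_partD[OF c] maximal_Ap[OF M(1)]])
      (use central_part_subset[of c] M(2) in blast)+
  then show ?thesis using False M by (auto simp: drop_non_central_def)
qed (use c in \<open>auto simp: drop_non_central_def\<close>)

lemma add_Omega_center_total:
  assumes c: "c \<in> Ap_chains G p"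
  shows "\<exists>c'\<in>Ap_chains G p. add_Omega_center c c'"
proof (cases "central_type (\<Union> c)")
  case True
  then obtain Q where Q: "sylow_subgroup G p Q" "\<Union> c \<subseteq> Omega_center G p Q" by (auto simp: central_type_def)
  have "insert (Omega_center G p Q) c \<in> Ap_chains G p"
    by (rule insert_top_Ap_chains[OF Ap_chainsD(2,4)[OF c] Omega_center_Ap[OF Q(1)] Q(2)])
  then show ?thesis using True Q by (auto simp: add_Omega_center_def)
next
  case False
  obtain M where M: "maximal M" "\<Union> c \<subseteq> M" using maximal_above_non_central[OF Union_chain_elem_ab[OF c] False] by metis
  have "\<Union> (central_part c) \<subseteq> M" using M(2) central_part_subset by blast
  then obtain Q where Q: "sylow_subgroup G p Q" "\<Union> (central_part c) \<subseteq> Omega_center G p Q" "Omega_center G p Q \<subseteq> M"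
    using Omega_center_between[OF central_type_Union_central_part[OF c] M(1)] by metis
  have 1: "insert (Omega_center G p Q) (central_part c) \<in> Ap_chains G p"
    by (rule insert_top_Ap_chains[OF central_partD[OF c] Omega_center_Ap[OF Q(1)] Q(2)])
  have "insert M (insert (Omega_center G p Q) (central_part c)) \<in> Ap_chains G p"
    by (rule insert_top_Ap_chains[OF Ap_chainsD(2,4)[OF 1] maximal_Ap[OF M(1)]]) (use Q(2,3) in auto)
  then show ?thesis using False M Q unfolding add_Omega_center_def by auto
qed

section \<open>Equivariance of the choices\<close>

lemma add_maximal_equivariant:
  assumes g: "g \<in> carrier G" and c: "c \<in> Ap_chains G p" and R: "add_maximal c c'"
  shows "add_maximal (conj_chain G g c) (conj_chain G g c')"
proof -
  have Uc: "\<Union> c \<subseteq> carrier G" using Ap_chainsD(3)[OF c] by blast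
  show ?thesis
    using R maximal_conj[OF g] conj_set_mono[of "\<Union> c" _ g]
    unfolding add_maximal_def Union_conj_chain central_type_conj_iff[OF g Uc]
    by (cases "central_type (\<Union> c)") (simp_all, metis conj_chain_insert)
qed

lemma drop_non_central_equivariant:
  assumes g: "g \<in> carrier G" and c: "c \<in> Ap_chains G p" and R: "drop_non_central c c'"
  shows "drop_non_central (conj_chain G g c) (conj_chain G g c')"
proof -
  have Uc: "\<Union> c \<subseteq> carrier G" using Ap_chainsD(3)[OF c] by blast
  show ?thesis
    using R maximal_conj[OF g] conj_set_mono[of "\<Union> c" _ g]
    unfolding drop_non_central_def Union_conj_chain central_type_conj_iff[OF g Uc]
      central_part_conj[OF g Ap_chainsD(3)[OF c]]
    by (cases "central_type (\<Union> c)") (simp_all, metis conj_chain_insert)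
qed

lemma add_Omega_center_equivariant:
  assumes g: "g \<in> carrier G" and c: "c \<in> Ap_chains G p" and R: "add_Omega_center c c'"
  shows "add_Omega_center (conj_chain G g c) (conj_chain G g c')"
proof -
  have Uc: "\<Union> c \<subseteq> carrier G" using Ap_chainsD(3)[OF c] by blast
  note eqs = add_Omega_center_def Union_conj_chain central_type_conj_iff[OF g Uc]
      central_part_conj[OF g Ap_chainsD(3)[OF c]]
  show ?thesis
  proof (cases "central_type (\<Union> c)")
    case True
    then obtain Q where Q: "sylow_subgroup G p Q" "\<Union> c \<subseteq> Omega_center G p Q" "c' = insert (Omega_center G p Q) c"
      using R by (auto simp: add_Omega_center_def)
    have "sylow_subgroup G p (conj_set G g Q)" "conj_set G g (\<Union> c) \<subseteq> Omega_center G p (conj_set G g Q)"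
      "conj_chain G g c' = insert (Omega_center G p (conj_set G g Q)) (conj_chain G g c)"
      using sylow_conj[OF Q(1) g] conj_set_mono[OF Q(2)]
      unfolding Omega_center_conj[OF sylowD(1)[OF Q(1)] g] Q(3) conj_chain_insert by auto
    then show ?thesis using True unfolding eqs by auto
  next
    case False
    then obtain M Q where MQ: "maximal M" "\<Union> c \<subseteq> M" "sylow_subgroup G p Q"
       "\<Union> (central_part c) \<subseteq> Omega_center G p Q" "Omega_center G p Q \<subseteq> M"
       "c' = insert M (insert (Omega_center G p Q) (central_part c))"
      using R by (auto simp: add_Omega_center_def)
    have "maximal (conj_set G g M)" "conj_set G g (\<Union> c) \<subseteq> conj_set G g M"
      "sylow_subgroup G p (conj_set G g Q)"
      "conj_set G g (\<Union> (central_part c)) \<subseteq> Omega_center G p (conj_set G g Q)"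
      "Omega_center G p (conj_set G g Q) \<subseteq> conj_set G g M"
      "conj_chain G g c' = insert (conj_set G g M) (insert (Omega_center G p (conj_set G g Q)) (conj_chain G g (central_part c)))"
      using maximal_conj[OF g MQ(1)] sylow_conj[OF MQ(3) g] MQ(2,4,5) conj_set_mono[of _ _ g]
      unfolding Omega_center_conj[OF sylowD(1)[OF MQ(3)] g] MQ(6) conj_chain_insert by auto
    then show ?thesis using False unfolding eqs by auto
  qed
qed

text \<open>The common core of the comparisons between different choices of \<open>M\<close>: the
  conjugator from \<open>M\<close> to \<open>N\<close> centralizes the top of \<open>c\<close>, so
  it fixes every member of \<open>e\<close>.\<close>

lemma conj_insert_maximal:
  assumes c: "c \<in> Ap_chains G p" and nc: "\<not> central_type (\<Union> c)"
    and M: "maximal M" "\<Union> c \<subseteq> M" and N: "maximal N" "\<Union> c \<subseteq> N" and e: "e \<subseteq> c" "insert N e \<subseteq> d"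
  shows "subconj (insert M e) d"
proof -
  obtain x where x: "x \<in> centralizer G (\<Union> c)" "conj_set G x M = N"
    using maximal_conjugate_over[OF nc M N] by blast
  have "conj_chain G x e = e"
    by (rule conj_chain_centralizer[OF x(1)]) (use e Ap_chainsD(3)[OF c] in blast)+
  then have "conj_chain G x (insert M e) \<subseteq> d" using x(2) e(2) by (simp add: conj_chain_insert)
  moreover have "x \<in> carrier G" using x(1) by (simp add: centralizer_def)
  ultimately show ?thesis by (auto simp: subconj_def)
qed

text \<open>If \<open>c\<close> has a non-central member, so does \<open>d\<close>, and the maximal
  subgroup chosen over \<open>d\<close> also lies over \<open>c\<close>.\<close>

lemma add_maximal_mono:
  assumes c: "c \<in> Ap_chains G p" and d: "d \<in> Ap_chains G p" "c \<subseteq> d"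
    and R: "add_maximal c c'" "add_maximal d d'"
  shows "subconj c' d'"
proof (cases "central_type (\<Union> c)")
  case True
  then have "c' = c" using R(1) by (simp add: add_maximal_def)
  moreover have "d \<subseteq> d'" using R(2) by (auto simp: add_maximal_def split: if_splits)
  ultimately show ?thesis using subset_imp_subconj[of c' d'] d(2) Ap_chainsD(3)[OF c] by auto
next
  case False
  then have "\<not> central_type (\<Union> d)" using central_type_subset[of "\<Union> c" "\<Union> d"] d(2) by blast
  then obtain N where N: "maximal N" "\<Union> d \<subseteq> N" "d' = insert N d" using R(2) by (auto simp: add_maximal_def)
  obtain M where M: "maximal M" "\<Union> c \<subseteq> M" "c' = insert M c" using False R(1) by (auto simp: add_maximal_def)
  show ?thesis unfolding M(3)
    by (rule conj_insert_maximal[OF c False M(1,2) N(1)]) (use N d(2) in auto)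
qed

text \<open>If all members of \<open>c\<close> are central, they survive in the central part of
  \<open>d\<close>; otherwise the maximal subgroups are matched as for
  \<open>add_maximal\<close>.\<close>

lemma drop_non_central_mono:
  assumes c: "c \<in> Ap_chains G p" and d: "d \<in> Ap_chains G p" "c \<subseteq> d"
    and R: "drop_non_central c c'" "drop_non_central d d'"
  shows "subconj c' d'"
proof (cases "central_type (\<Union> c)")
  case True
  then have "c' = c" using R(1) by (simp add: drop_non_central_def)
  moreover have "central_part d \<subseteq> d'"
    using R(2) central_part_subset[of d] by (auto simp: drop_non_central_def split: if_splits)
  ultimately show ?thesis
    using subset_imp_subconj[of c' d'] central_part_mono[OF d(2)] central_part_eq[OF True] Ap_chainsD(3)[OF c] by auto
next
  case False
  then have "\<not> central_type (\<Union> d)" using central_type_subset[of "\<Union> c" "\<Union> d"] d(2) by blast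
  then obtain N where N: "maximal N" "\<Union> d \<subseteq> N" "d' = insert N (central_part d)"
    using R(2) by (auto simp: drop_non_central_def)
  obtain M where M: "maximal M" "\<Union> c \<subseteq> M" "c' = insert M (central_part c)"
    using False R(1) by (auto simp: drop_non_central_def)
  show ?thesis unfolding M(3)
    by (rule conj_insert_maximal[OF c False M(1,2) N(1)])
      (use N d(2) central_part_subset[of c] central_part_mono[OF d(2)] in auto)
qed

lemma drop_non_central_le_add_maximal:
  assumes c: "c \<in> Ap_chains G p" and R: "drop_non_central c c'" "add_maximal c c''"
  shows "subconj c' c''"
proof (cases "central_type (\<Union> c)")
  case True
  then have "c' = c" "c'' = c" using R by (auto simp: drop_non_central_def add_maximal_def)
  then show ?thesis using subset_imp_subconj Ap_chainsD(3)[OF c] by blast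
next
  case False
  obtain M where M: "maximal M" "\<Union> c \<subseteq> M" "c' = insert M (central_part c)"
    using False R(1) by (auto simp: drop_non_central_def)
  obtain N where N: "maximal N" "\<Union> c \<subseteq> N" "c'' = insert N c" using False R(2) by (auto simp: add_maximal_def)
  show ?thesis unfolding M(3)
    by (rule conj_insert_maximal[OF c False M(1,2) N(1,2)]) (use N central_part_subset[of c] in auto)
qed

lemma drop_non_central_le_add_Omega_center:
  assumes c: "c \<in> Ap_chains G p" and R: "drop_non_central c c'" "add_Omega_center c c''"
  shows "subconj c' c''"
proof (cases "central_type (\<Union> c)")
  case True
  then have "c' = c" "c \<subseteq> c''" using R by (auto simp: drop_non_central_def add_Omega_center_def)
  then show ?thesis using subset_imp_subconj Ap_chainsD(3)[OF c] by blast
next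
  case False
  obtain M where M: "maximal M" "\<Union> c \<subseteq> M" "c' = insert M (central_part c)"
    using False R(1) by (auto simp: drop_non_central_def)
  obtain N where N: "maximal N" "\<Union> c \<subseteq> N" "insert N (central_part c) \<subseteq> c''"
    using False R(2) by (auto simp: add_Omega_center_def)
  show ?thesis unfolding M(3)
    by (rule conj_insert_maximal[OF c False M(1,2) N(1,2) central_part_subset N(3)])
qed

text \<open>In the mixed case two conjugations are composed: the first matches the maximal
  subgroups, the second matches the subgroups \<open>\<Omega>\<^sub>Q\<close> below them while
  stabilizing the maximal one.\<close>

lemma add_Omega_center_mono:
  assumes c: "c \<in> Ap_chains G p" and d: "d \<in> Ap_chains G p" "c \<subseteq> d"
    and R: "add_Omega_center c c'" "add_Omega_center d d'"
  shows "subconj c' d'"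
proof -
  have cent: "x \<in> carrier G" if "x \<in> centralizer G E" for x E using that by (simp add: centralizer_def)
  let ?e = "central_part c"
  have ec: "?e \<subseteq> Pow (carrier G)" using central_part_subset[of c] Ap_chainsD(3)[OF c] by blast
  have Uec: "\<Union> ?e \<subseteq> carrier G" using ec by blast
  \<comment> \<open>Both cases for \<open>d\<close> put some \<open>\<Omega>\<^sub>Q\<close> above
    its central members, so for central \<open>c\<close> they can be treated together.\<close>
  have "\<exists>Q. sylow_subgroup G p Q \<and> \<Union> (central_part d) \<subseteq> Omega_center G p Q
      \<and> insert (Omega_center G p Q) (central_part d) \<subseteq> d'"
    using R(2) central_part_eq[of d] by (auto simp: add_Omega_center_def split: if_splits)
  then obtain Q' where Q': "sylow_subgroup G p Q'" "\<Union> (central_part d) \<subseteq> Omega_center G p Q'"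
      "insert (Omega_center G p Q') (central_part d) \<subseteq> d'" by metis
  have eQ': "\<Union> ?e \<subseteq> Omega_center G p Q'" using Q'(2) central_part_mono[OF d(2)] by blast
  show ?thesis
  proof (cases "central_type (\<Union> c)")
    case True
    then obtain Q where Q: "sylow_subgroup G p Q" "\<Union> c \<subseteq> Omega_center G p Q" "c' = insert (Omega_center G p Q) c"
      using R(1) by (auto simp: add_Omega_center_def)
    have ce: "?e = c" using central_part_eq[OF True] .
    obtain x where x: "x \<in> centralizer G (\<Union> c)" "conj_set G x (Omega_center G p Q) = Omega_center G p Q'"
      using Omega_center_conjugate_over[OF Q(1,2) Q'(1)] eQ' ce by auto
    have "conj_chain G x c = c"
      by (rule conj_chain_centralizer[OF x(1) order_refl]) (use ec ce in simp)
    then have "conj_chain G x c' = insert (Omega_center G p Q') ?e"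
      unfolding Q(3) conj_chain_insert x(2) ce by simp
    moreover have "insert (Omega_center G p Q') ?e \<subseteq> d'" using Q'(3) central_part_mono[OF d(2)] by auto
    ultimately show ?thesis using cent[OF x(1)] unfolding subconj_def by metis
  next
    case False
    then have nd: "\<not> central_type (\<Union> d)" using central_type_subset[of "\<Union> c" "\<Union> d"] d(2) by blast
    obtain M Q where Q: "maximal M" "\<Union> c \<subseteq> M" "sylow_subgroup G p Q"
       "\<Union> ?e \<subseteq> Omega_center G p Q" "Omega_center G p Q \<subseteq> M" "c' = insert M (insert (Omega_center G p Q) ?e)"
      using R(1) False by (auto simp: add_Omega_center_def)
    obtain N T where T: "maximal N" "\<Union> d \<subseteq> N" "sylow_subgroup G p T"
       "\<Union> (central_part d) \<subseteq> Omega_center G p T" "Omega_center G p T \<subseteq> N"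
       "d' = insert N (insert (Omega_center G p T) (central_part d))"
      using R(2) nd by (auto simp: add_Omega_center_def)
    have cN: "\<Union> c \<subseteq> N" using T(2) d(2) by blast
    have eT: "\<Union> ?e \<subseteq> Omega_center G p T" using T(4) central_part_mono[OF d(2)] by blast
    obtain x where x: "x \<in> centralizer G (\<Union> c)" "conj_set G x M = N"
      using maximal_conjugate_over[OF False Q(1,2) T(1) cN] by blast
    have xc: "x \<in> carrier G" using cent[OF x(1)] .
    have xW: "Omega_center G p (conj_set G x Q) = conj_set G x (Omega_center G p Q)"
      by (rule Omega_center_conj[OF sylowD(1)[OF Q(3)] xc])
    have xe: "conj_set G x (\<Union> ?e) = \<Union> ?e"
      by (rule conj_set_centralizer[OF x(1) _ Uec]) (use central_part_subset[of c] in blast)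
    have "\<Union> ?e \<subseteq> Omega_center G p (conj_set G x Q)" "Omega_center G p (conj_set G x Q) \<subseteq> N"
      using conj_set_mono[OF Q(4), of x] conj_set_mono[OF Q(5), of x] unfolding xW xe x(2) by auto
    \<comment> \<open>\<open>y\<close> is taken to centralize the union of the central members,
      which suffices because \<open>c'\<close> consists of these, \<open>M\<close> and
      \<open>\<Omega>\<^sub>Q\<close>. This is why non-central members are dropped first. Since
      \<open>y\<close> fixes \<open>N\<close>, the effect of \<open>x\<close> on \<open>M\<close> is
      kept.\<close>
    then obtain y where y: "y \<in> centralizer G (\<Union> ?e)" "conj_set G y N = N"
        "conj_set G y (Omega_center G p (conj_set G x Q)) = Omega_center G p T"
      using Omega_center_conjugate_within[OF sylow_conj[OF Q(3) xc] _ _ T(3) eT T(5,1)] by blast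
    have yc: "y \<in> carrier G" using cent[OF y(1)] .
    have "conj_set G (y \<otimes> x) M = N"
      using conj_set_mult[OF yc xc maximalD(4)[OF Q(1)]] x(2) y(2) by simp
    moreover have "conj_set G (y \<otimes> x) (Omega_center G p Q) = Omega_center G p T"
      using conj_set_mult[OF yc xc sylowD(5)[OF Q(3)]] y(3) xW by simp
    moreover have "conj_chain G x ?e = ?e"
      by (rule conj_chain_centralizer[OF x(1) _ ec]) (use central_part_subset[of c] in blast)
    then have "conj_chain G (y \<otimes> x) ?e = ?e"
      using conj_chain_mult[OF yc xc ec] conj_chain_centralizer[OF y(1) order_refl ec] by simp
    ultimately have "conj_chain G (y \<otimes> x) c' = insert N (insert (Omega_center G p T) ?e)"
      unfolding Q(6) conj_chain_insert by simp
    moreover have "insert N (insert (Omega_center G p T) ?e) \<subseteq> d'"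
      unfolding T(6) using central_part_mono[OF d(2)] by blast
    ultimately show ?thesis using m_closed[OF yc xc] unfolding subconj_def by metis
  qed
qed

lemma only_Omega_center_le_add_Omega_center:
  assumes R: "only_Omega_center c c'" "add_Omega_center c c''"
  shows "subconj c' c''"
proof -
  obtain Q where Q: "sylow_subgroup G p Q" "c' = {Omega_center G p Q}" using R(1) by (auto simp: only_Omega_center_def)
  obtain T where T: "sylow_subgroup G p T" "Omega_center G p T \<in> c''"
    using R(2) by (auto simp: add_Omega_center_def split: if_splits)
  \<comment> \<open>The centralizer of the empty set is all of \<open>G\<close>, so this instance
    says that all \<open>\<Omega>\<^sub>Q\<close> are conjugate in \<open>G\<close>.\<close>
  obtain x where x: "x \<in> centralizer G {}" "conj_set G x (Omega_center G p Q) = Omega_center G p T"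
    using Omega_center_conjugate_over[OF Q(1) _ T(1), of "{}"] by auto
  have "x \<in> carrier G" using x(1) by (simp add: centralizer_def)
  moreover have "conj_chain G x c' \<subseteq> c''" using x(2) T(2) Q(2) by (simp add: conj_chain_eq)
  ultimately show ?thesis unfolding subconj_def by metis
qed

theorem contractible_orbit_space: "contractible_space (orbit_space G p)"
proof -
  let ?X = "orbit_space G p"
  obtain Q where Q: "sylow_subgroup G p Q" using sylow_subgroup_exists[OF prime_p finite_carrier] by blast
  let ?a = "chain_orbit {Omega_center G p Q}"
  have aQ: "{Omega_center G p Q} \<in> Ap_chains G p" using Omega_center_Ap[OF Q] by (auto simp: Ap_chains_def)
  obtain f1 where f1: "induces p add_maximal f1"
    using induces_exists[OF add_maximal_total add_maximal_equivariant] by blast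
  obtain f2 where f2: "induces p drop_non_central f2"
    using induces_exists[OF drop_non_central_total drop_non_central_equivariant] by blast
  obtain f3 where f3: "induces p add_Omega_center f3"
    using induces_exists[OF add_Omega_center_total add_Omega_center_equivariant] by blast
  \<comment> \<open>The identity and the constant map are also presented by relations on chains, so
    that the same comparison lemma covers the two ends.\<close>
  have f0: "induces p (=) id" by (auto simp: induces_def)
  have f4: "induces p only_Omega_center (\<lambda>_. ?a)" using aQ Q by (auto simp: induces_def only_Omega_center_def)
  have c0: "continuous_map ?X ?X id" by simp
  have c1: "continuous_map ?X ?X f1" by (rule induces_continuous[OF f1 add_maximal_mono])
  have c2: "continuous_map ?X ?X f2" by (rule induces_continuous[OF f2 drop_non_central_mono])
  have c3: "continuous_map ?X ?X f3" by (rule induces_continuous[OF f3 add_Omega_center_mono])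
  have c4: "continuous_map ?X ?X (\<lambda>_. ?a)"
    using aQ by (auto simp: topspace_orbit_space chain_orbits_eq)
  have h01: "homotopic_with (\<lambda>_. True) ?X ?X id f1"
  proof (rule induces_homotopic[OF f0 f1 c0 c1])
    fix c c' c'' assume *: "c \<in> Ap_chains G p" "c = c'" "add_maximal c c''"
    then have "c' \<subseteq> c''" by (auto simp: add_maximal_def split: if_splits)
    then show "subconj c' c''" using subset_imp_subconj Ap_chainsD(3) * by blast
  qed
  have h21: "homotopic_with (\<lambda>_. True) ?X ?X f2 f1"
    by (rule induces_homotopic[OF f2 f1 c2 c1 drop_non_central_le_add_maximal])
  have h23: "homotopic_with (\<lambda>_. True) ?X ?X f2 f3"
    by (rule induces_homotopic[OF f2 f3 c2 c3 drop_non_central_le_add_Omega_center])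
  have h43: "homotopic_with (\<lambda>_. True) ?X ?X (\<lambda>_. ?a) f3"
    by (rule induces_homotopic[OF f4 f3 c4 c3 only_Omega_center_le_add_Omega_center])
  \<comment> \<open>The zigzag is \<open>id\<close> \<le> \<open>f1\<close> \<ge> \<open>f2\<close>
    \<le> \<open>f3\<close> \<ge> constant; symmetry reverses the second and fourth
    comparisons.\<close>
  have "homotopic_with (\<lambda>_. True) ?X ?X id (\<lambda>_. ?a)"
    using homotopic_with_trans[OF homotopic_with_trans[OF h01 homotopic_with_symD[OF h21]]
        homotopic_with_trans[OF h23 homotopic_with_symD[OF h43]]] .
  then show ?thesis unfolding contractible_space_def by blast
qed

end

subsection \<open>Ranks\<close>

context group
begin

text \<open>The generators lie in the subgroup \<open>Omega_center G p Q\<close>, and conversely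
  each of its elements is the identity or has order exactly \<open>p\<close>.\<close>

lemma Omega1_center_of:
  assumes p: "prime p" and Q: "subgroup Q G"
  shows "Omega1 G p (center_of G Q) = Omega_center G p Q"
proof
  have sub: "subgroup (Omega_center G p Q) G" using elem_ab_Omega_center[OF Q] by (simp add: elem_ab_def)
  have c: "x \<in> carrier G" if "x \<in> center_of G Q" for x
    using that subgroup.mem_carrier[OF subgroup_center_of[OF Q]] by simp
  show "Omega1 G p (center_of G Q) \<subseteq> Omega_center G p Q"
    unfolding Omega1_def
  proof (rule generate_subgroup_incl[OF _ sub], rule subsetI)
    fix x assume "x \<in> {x \<in> center_of G Q. ord x = p}"
    then show "x \<in> Omega_center G p Q" using c pow_ord_eq_1[of x] by (auto simp: Omega_center_def)
  qed
  show "Omega_center G p Q \<subseteq> Omega1 G p (center_of G Q)"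
  proof
    fix x assume x: "x \<in> Omega_center G p Q"
    then have xc: "x \<in> carrier G" "x \<in> center_of G Q" "x [^] p = \<one>" using c by (auto simp: Omega_center_def)
    show "x \<in> Omega1 G p (center_of G Q)"
    proof (cases "x = \<one>")
      case True
      then show ?thesis unfolding Omega1_def by (simp add: generate.one)
    next
      case False
      have "ord x dvd p" using xc by (simp add: pow_eq_id)
      then have "ord x = p" using p False xc ord_eq_1[of x] by (auto simp: prime_nat_iff)
      then show ?thesis unfolding Omega1_def using xc by (auto intro: generate.incl)
    qed
  qed
qed

text \<open>A non-trivial central element has order \<open>p ^ i\<close> with \<open>i > 0\<close>;
  its power with exponent \<open>p ^ (i - 1)\<close> is non-trivial and killed by
  \<open>p\<close>.\<close>

lemma Omega_center_nontrivial:
  assumes p: "prime p" and fin: "finite (carrier G)" and Q: "subgroup Q G" "card Q = p ^ n" "n > 0"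
  shows "Omega_center G p Q \<noteq> {\<one>}"
proof -
  interpret Q: group "G\<lparr>carrier := Q\<rparr>" using Q(1) is_group by (rule subgroup.subgroup_is_group)
  have finQ: "finite Q" using fin subgroup.subset[OF Q(1)] by (rule rev_finite_subset)
  have "\<exists>z\<in>center_of (G\<lparr>carrier := Q\<rparr>) (carrier (G\<lparr>carrier := Q\<rparr>)). z \<noteq> \<one>\<^bsub>G\<lparr>carrier := Q\<rparr>\<^esub>"
    by (rule Q.p_group_center_nontrivial[OF p]) (use Q finQ in \<open>auto simp: order_def\<close>)
  then obtain z where z: "z \<in> center_of G Q" "z \<noteq> \<one>" by (auto simp: center_of_def)
  note Z = subgroup_center_of[OF Q(1)]
  have zc: "z \<in> carrier G" using subgroup.mem_carrier[OF Z z(1)] .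
  have "z [^]\<^bsub>G\<lparr>carrier := Q\<rparr>\<^esub> order (G\<lparr>carrier := Q\<rparr>) = \<one>\<^bsub>G\<lparr>carrier := Q\<rparr>\<^esub>"
    by (rule Q.pow_order_eq_1) (use z in \<open>auto simp: center_of_def\<close>)
  then have "z [^] (p ^ n) = \<one>" using Q(2) nat_pow_consistent[of z "p ^ n" Q] by (simp add: order_def)
  then have "ord z dvd p ^ n" using zc by (simp add: pow_eq_id)
  then obtain i where i: "ord z = p ^ i" using p by (auto simp: divides_primepow_nat)
  have "i \<noteq> 0" using i z(2) zc ord_eq_1[of z] by auto
  then obtain j where j: "i = Suc j" by (cases i) auto
  let ?y = "z [^] (p ^ j)"
  have "?y [^] p = z [^] (p ^ i)" using zc by (simp add: nat_pow_pow j mult.commute)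
  then have "?y [^] p = \<one>" using pow_ord_eq_1[OF zc] i by simp
  moreover have "?y \<noteq> \<one>"
  proof
    assume "?y = \<one>"
    then have "p ^ i dvd p ^ j" using zc i by (simp add: pow_eq_id)
    then have "i \<le> j" using power_dvd_imp_le[OF _ prime_gt_1_nat[OF p]] by blast
    then show False using j by simp
  qed
  moreover have "?y \<in> center_of G Q"
    using subgroup_int_pow_closed[OF Z z(1), of "int (p ^ j)"] zc by (metis int_pow_int)
  ultimately show ?thesis by (auto simp: Omega_center_def)
qed

lemma p_rank_facts:
  assumes p: "prime p" and fin: "finite (carrier G)"
  shows p_rank_ge: "elem_ab G p E \<Longrightarrow> E \<subseteq> H \<Longrightarrow> card E = p ^ k \<Longrightarrow> k \<le> p_rank G p H"
    and p_rank_le: "subgroup H G \<Longrightarrow> card H = p ^ k \<Longrightarrow> p_rank G p H \<le> k"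
proof -
  define S where "S H = {r. \<exists>E. elem_ab G p E \<and> E \<subseteq> H \<and> card E = p ^ r}" for H
  have rank: "p_rank G p H = Max (S H)" for H by (simp add: p_rank_def S_def)
  have finS: "finite (S H)" for H
  proof (rule finite_subset)
    \<comment> \<open>The maximum needs a finite set of exponents: \<open>r < p ^ r\<close>, and
      \<open>p ^ r\<close> is at most the order of the group.\<close>
    show "S H \<subseteq> {..card (carrier G)}"
    proof
      fix r assume "r \<in> S H"
      then obtain E where E: "elem_ab G p E" "card E = p ^ r" by (auto simp: S_def)
      have "r < p ^ r" using power_gt_expt[of p r] prime_gt_1_nat[OF p] by simp
      moreover have "card E \<le> card (carrier G)" using card_mono[OF fin elem_ab_carrier[OF E(1)]] .
      ultimately show "r \<in> {..card (carrier G)}" using E by simp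
    qed
  qed simp
  show "k \<le> p_rank G p H" if "elem_ab G p E" "E \<subseteq> H" "card E = p ^ k"
    unfolding rank by (rule Max_ge[OF finS]) (use that in \<open>auto simp: S_def\<close>)
  show "p_rank G p H \<le> k" if H: "subgroup H G" "card H = p ^ k"
  proof -
    \<comment> \<open>The trivial subgroup contributes the exponent 0, so the maximum is
      attained.\<close>
    have "elem_ab G p {\<one>}" using triv_subgroup by (simp add: elem_ab_def)
    then have "0 \<in> S H" using subgroup.one_closed[OF H(1)] unfolding S_def by (intro CollectI exI[of _ "{\<one>}"]) auto
    then have "Max (S H) \<in> S H" using Max_in[OF finS] by blast
    then obtain E where E: "E \<subseteq> H" "card E = p ^ Max (S H)" by (auto simp: S_def)
    have "finite H" using fin subgroup.subset[OF H(1)] by (rule rev_finite_subset)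
    then have "p ^ Max (S H) \<le> p ^ k" using card_mono[OF _ E(1)] E(2) H(2) by simp
    then show ?thesis unfolding rank using p prime_gt_1_nat power_increasing_iff by blast
  qed
qed

end

theorem theorem5p9:
  fixes G :: "('a, 'b) monoid_scheme" and p :: nat and P :: "'a set"
  assumes "group G" and "finite (carrier G)" and "prime p" and "p dvd order G"
    and "sylow_subgroup G p P"
    and "p_rank G p (carrier G) \<le> p_rank G p (Omega1 G p (center_of G P)) + 1"
  shows "contractible_space (orbit_space G p)"
proof -
  interpret group G by fact
  note fin = assms(2) and p = assms(3) and P = assms(5)
  let ?W = "Omega_center G p P"
  have sP: "subgroup P G" "card P = p ^ multiplicity p (order G)" using P by (auto simp: sylow_subgroup_def)
  have W: "elem_ab G p ?W" using elem_ab_Omega_center[OF sP(1)] .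
  obtain r where r: "card ?W = p ^ r" using card_elem_ab[OF p fin W] by blast
  have "order G > 0" using fin order_gt_0_iff_finite by simp
  then have "multiplicity p (order G) > 0" using assms(4) p by (simp add: prime_multiplicity_gt_zero_iff)
  then have W1: "?W \<noteq> {\<one>\<^bsub>G\<^esub>}" using Omega_center_nontrivial[OF p fin sP] by simp
  \<comment> \<open>\<open>p ^ r\<close> is the order of \<open>?W\<close>, so its rank is at most
    \<open>r\<close> and that of \<open>G\<close> at most \<open>Suc r\<close>.\<close>
  have "p_rank G p ?W \<le> r" using p_rank_le[OF p fin _ r] W by (simp add: elem_ab_def)
  then have rank: "p_rank G p (carrier G) \<le> Suc r" using assms(6) Omega1_center_of[OF p sP(1)] by simp
  interpret p_rank_gap G p r
  proof
    show "finite (carrier G)" "prime p" by fact+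
    show "r > 0"
    proof (rule ccontr)
      assume "\<not> r > 0"
      then have "card ?W = 1" using r by simp
      then obtain w where "?W = {w}" using card_1_singletonE by blast
      moreover have "\<one>\<^bsub>G\<^esub> \<in> ?W" using W subgroup.one_closed by (auto simp: elem_ab_def)
      ultimately show False using W1 by simp
    qed
    fix E assume E: "elem_ab G p E"
    obtain k where k: "card E = p ^ k" using card_elem_ab[OF p fin E] by blast
    have "k \<le> Suc r" using p_rank_ge[OF p fin E elem_ab_carrier[OF E] k] rank by simp
    then show "card E \<le> p ^ Suc r" unfolding k using p by (intro power_increasing) (auto simp: prime_gt_0_nat Suc_leI)
  next
    fix Q assume Q: "sylow_subgroup G p Q"
    \<comment> \<open>The order is known for the given \<open>P\<close>; Sylow conjugacy, with
      \<open>G\<close> as its own subgroup, carries it over to every \<open>Q\<close>.\<close>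
    obtain x where x: "x \<in> carrier G" "conj_set G x P = Q"
      using sylow_in_conjugate[OF p fin subgroup_self, of P Q] P Q by auto
    have "card (conj_set G x ?W) = card ?W" using card_conj_set[OF x(1) elem_ab_carrier[OF W]] .
    then show "card (Omega_center G p Q) = p ^ r"
      using Omega_center_conj[OF sP(1) x(1)] x(2) r by simp
  qed
  show ?thesis by (rule contractible_orbit_space)
qed

end
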